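(* Consider the triangular array: for each $n$, $p_n\ge1$, fixed $\mathbf{X}_n\in\mathbb{R}^{n\times p_n}$, $\beta^0_n\in\mathbb{R}^{p_n}$, $\mathbf{Y}_n=\mathbf{X}_n\beta^0_n+\varepsilon_n$ with $\varepsilon_{n,i}$ i.i.d. $\mathcal{N}(0,\sigma^2)$, $\sigma>0$; Ridge parameters $\lambda_n>0$ with $\Omega_{\min}(\lambda_n)>0$ and $n^{1/2}\|\theta^0_n\|_2\lambda_n\Omega_{\min}(\lambda_n)^{-1/2}\lambda_{\min\neq0}(\hat\Sigma_n)^{-1}\to0$; an estimator $\hat\beta_{\mathrm{init}}$ and constants $\Delta_{j,n}>0$ with $\mathbb{P}[\bigcap_{j=1}^{p_n}\{|a_{n,p;j}(\sigma)\sum_{k\neq j}(P_{\mathbf{X}})_{jk}(\hat\beta_{\mathrm{init};k}-\beta^0_k)|\le\Delta_{j,n}\}]\to1$. Fix $\zeta>0$ and use the corrected p-values $P_{\mathrm{corr};j}=F_Z(P_j+\zeta)$. Then for every $0<\alpha<1$, $\limsup_{n\to\infty}\mathbb{P}[|V_\alpha|>0]\le\alpha$. Furthermore, there exists a sequence $\eta_n\to0$ such that for every sequence $\alpha_n\in(0,1)$ with $\alpha_n\to0$ and $\alpha_n\ge\eta_n$ for all $n$, $\limsup_{n\to\infty}\big(\mathbb{P}[|V_{\alpha_n}|>0]-\alpha_n\big)\le0$.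
   Context: $\hat\Sigma_n=n^{-1}\mathbf{X}_n^T\mathbf{X}_n$; $P_{\mathbf{X}}=\mathbf{X}_n^T(\mathbf{X}_n\mathbf{X}_n^T)^{-}\mathbf{X}_n$ (Moore–Penrose pseudo-inverse); $\theta^0_n=P_{\mathbf{X}}\beta^0_n$; $\Omega(\lambda)=(\hat\Sigma_n+\lambda I)^{-1}\hat\Sigma_n(\hat\Sigma_n+\lambda I)^{-1}$, $\Omega_{\min}(\lambda)=\min_j\Omega_{jj}(\lambda)$; $\lambda_{\min\neq0}(A)$ = smallest nonzero eigenvalue; $a_{n,p;j}(\sigma)=n^{1/2}\sigma^{-1}\Omega_{jj}(\lambda_n)^{-1/2}$. Ridge $\hat\beta=(\hat\Sigma_n+\lambda_nI)^{-1}n^{-1}\mathbf{X}_n^T\mathbf{Y}_n$, $\hat\beta_{\mathrm{corr};j}=\hat\beta_j-\sum_{k\neq j}(P_{\mathbf{X}})_{jk}\hat\beta_{\mathrm{init};k}$. $P_j=2\big(1-\Phi\big((a_{n,p;j}(\sigma)|\hat\beta_{\mathrm{corr};j}|-\Delta_{j,n})_+\big)\big)$, $\Phi$ the standard normal cdf. $F_Z(c)=\mathbb{P}[\min_{1\le j\le p_n}2(1-\Phi(a_{n,p;j}(\sigma)|Z_j|))\le c]$ with $(Z_1,\ldots,Z_{p_n})\sim\mathcal{N}_{p_n}(0,n^{-1}\sigma^2\Omega(\lambda_n))$. $\hat S_\alpha=\{j:P_{\mathrm{corr};j}\le\alpha\}$, $S_0=\{j:\beta^0_{n,j}\neq0\}$,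 and $V_\alpha=\hat S_\alpha\cap S_0^c$ (set of false positives). *)

theory Defs
  imports "HOL-Probability.Probability"
begin

(* Matrices of varying dimension are represented as functions nat => nat => real;
   only the entries with indices inside the stated dimensions are meaningful.
   Vectors are functions nat => real. *)
type_synonym rmat = "nat \<Rightarrow> nat \<Rightarrow> real"
type_synonym rvec = "nat \<Rightarrow> real"

definition mmul :: "nat \<Rightarrow> rmat \<Rightarrow> rmat \<Rightarrow> rmat" where
  "mmul k A B = (\<lambda>i j. \<Sum>l<k. A i l * B l j)"

definition mtr :: "rmat \<Rightarrow> rmat" where
  "mtr A = (\<lambda>i j. A j i)"

definition idm :: rmat where
  "idm = (\<lambda>i j. if i = j then 1 else 0)"

definition zero_outside :: "nat \<Rightarrow> nat \<Rightarrow> rmat \<Rightarrow> bool" where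
  "zero_outside m q B \<longleftrightarrow> (\<forall>i j. (m \<le> i \<or> q \<le> j) \<longrightarrow> B i j = 0)"

definition eq_on :: "nat \<Rightarrow> nat \<Rightarrow> rmat \<Rightarrow> rmat \<Rightarrow> bool" where
  "eq_on m q A B \<longleftrightarrow> (\<forall>i<m. \<forall>j<q. A i j = B i j)"

definition minv :: "nat \<Rightarrow> rmat \<Rightarrow> rmat" where
  "minv p A = (THE B. zero_outside p p B \<and> eq_on p p (mmul p A B) idm \<and> eq_on p p (mmul p B A) idm)"

(* Moore-Penrose pseudo-inverse of an m x q matrix A (a q x m matrix), via the Penrose equations *)
definition pinv :: "nat \<Rightarrow> nat \<Rightarrow> rmat \<Rightarrow> rmat" where
  "pinv m q A = (THE B. zero_outside q m B
      \<and> eq_on m q (mmul m (mmul q A B) A) A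
      \<and> eq_on q m (mmul q (mmul m B A) B) B
      \<and> eq_on m m (mtr (mmul q A B)) (mmul q A B)
      \<and> eq_on q q (mtr (mmul m B A)) (mmul m B A))"

definition is_eigenvalue :: "nat \<Rightarrow> rmat \<Rightarrow> real \<Rightarrow> bool" where
  "is_eigenvalue p A k \<longleftrightarrow> (\<exists>v::rvec. (\<exists>i<p. v i \<noteq> 0) \<and> (\<forall>i<p. (\<Sum>j<p. A i j * v j) = k * v i))"

definition lambda_min_nz :: "nat \<Rightarrow> rmat \<Rightarrow> real" where
  "lambda_min_nz p A = Min {k. k \<noteq> 0 \<and> is_eigenvalue p A k}"

definition msqrt :: "nat \<Rightarrow> rmat \<Rightarrow> rmat" where
  "msqrt p C = (THE S. zero_outside p p S \<and> eq_on p p (mtr S) S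
      \<and> (\<forall>v::rvec. 0 \<le> (\<Sum>i<p. \<Sum>j<p. v i * S i j * v j))
      \<and> eq_on p p (mmul p S S) C)"

definition std_normal :: "real measure" where
  "std_normal = density lborel std_normal_density"

definition Phi :: "real \<Rightarrow> real" where
  "Phi x = measure std_normal {..x}"

(* the law N_p(0, C) (centred Gaussian with covariance C) on the coordinates {..<p},
   realised as the law of C^(1/2) g with g ~ N_p(0, I) *)
definition gauss_law :: "nat \<Rightarrow> rmat \<Rightarrow> rvec measure" where
  "gauss_law p C = distr (PiM {..<p} (\<lambda>_. std_normal)) (PiM {..<p} (\<lambda>_. borel))
      (\<lambda>g. \<lambda>j\<in>{..<p}. \<Sum>k<p. msqrt p C j k * g k)"

definition noise_law :: "nat \<Rightarrow> real \<Rightarrow> rvec measure" where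
  "noise_law n \<sigma> = PiM {..<n} (\<lambda>_. density lborel (normal_density 0 \<sigma>))"

definition Sigma_hat :: "nat \<Rightarrow> rmat \<Rightarrow> rmat" where
  "Sigma_hat n X = (\<lambda>i j. (1 / real n) * (\<Sum>l<n. X l i * X l j))"

definition PX :: "nat \<Rightarrow> nat \<Rightarrow> rmat \<Rightarrow> rmat" where
  "PX n p X = mmul n (mmul n (mtr X) (pinv n n (mmul p X (mtr X)))) X"

definition ridge_res :: "nat \<Rightarrow> nat \<Rightarrow> rmat \<Rightarrow> real \<Rightarrow> rmat" where
  "ridge_res n p X lam = minv p (\<lambda>i j. Sigma_hat n X i j + lam * idm i j)"

definition Omega :: "nat \<Rightarrow> nat \<Rightarrow> rmat \<Rightarrow> real \<Rightarrow> rmat" where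
  "Omega n p X lam = mmul p (mmul p (ridge_res n p X lam) (Sigma_hat n X)) (ridge_res n p X lam)"

definition Omega_min :: "nat \<Rightarrow> nat \<Rightarrow> rmat \<Rightarrow> real \<Rightarrow> real" where
  "Omega_min n p X lam = Min ((\<lambda>j. Omega n p X lam j j) ` {..<p})"

definition acoef :: "nat \<Rightarrow> nat \<Rightarrow> rmat \<Rightarrow> real \<Rightarrow> real \<Rightarrow> nat \<Rightarrow> real" where
  "acoef n p X \<sigma> lam j = sqrt (real n) / \<sigma> / sqrt (Omega n p X lam j j)"

definition ridge :: "nat \<Rightarrow> nat \<Rightarrow> rmat \<Rightarrow> real \<Rightarrow> rvec \<Rightarrow> rvec" where
  "ridge n p X lam Y = (\<lambda>j. \<Sum>k<p. ridge_res n p X lam j k * ((1 / real n) * (\<Sum>i<n. X i k * Y i)))"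

definition response :: "nat \<Rightarrow> nat \<Rightarrow> rmat \<Rightarrow> rvec \<Rightarrow> rvec \<Rightarrow> rvec" where
  "response n p X \<beta>0 \<epsilon> = (\<lambda>i. (\<Sum>k<p. X i k * \<beta>0 k) + \<epsilon> i)"

definition ridge_corr :: "nat \<Rightarrow> nat \<Rightarrow> rmat \<Rightarrow> real \<Rightarrow> rvec \<Rightarrow> rvec \<Rightarrow> rvec" where
  "ridge_corr n p X lam Y binit = (\<lambda>j. ridge n p X lam Y j - (\<Sum>k\<in>{..<p} - {j}. PX n p X j k * binit k))"

definition pval :: "nat \<Rightarrow> nat \<Rightarrow> rmat \<Rightarrow> real \<Rightarrow> real \<Rightarrow> rvec \<Rightarrow> rvec \<Rightarrow> rvec \<Rightarrow> nat \<Rightarrow> real" where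
  "pval n p X \<sigma> lam \<Delta> Y binit j =
     2 * (1 - Phi (max 0 (acoef n p X \<sigma> lam j * \<bar>ridge_corr n p X lam Y binit j\<bar> - \<Delta> j)))"

definition FZ :: "nat \<Rightarrow> nat \<Rightarrow> rmat \<Rightarrow> real \<Rightarrow> real \<Rightarrow> real \<Rightarrow> real" where
  "FZ n p X \<sigma> lam c =
     (let L = gauss_law p (\<lambda>i j. \<sigma>\<^sup>2 / real n * Omega n p X lam i j)
      in measure L {z \<in> space L. Min ((\<lambda>j. 2 * (1 - Phi (acoef n p X \<sigma> lam j * \<bar>z j\<bar>))) ` {..<p}) \<le> c})"

definition pcorr :: "nat \<Rightarrow> nat \<Rightarrow> rmat \<Rightarrow> real \<Rightarrow> real \<Rightarrow> rvec \<Rightarrow> real \<Rightarrow> rvec \<Rightarrow> rvec \<Rightarrow> nat \<Rightarrow> real" where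
  "pcorr n p X \<sigma> lam \<Delta> \<zeta> Y binit j = FZ n p X \<sigma> lam (pval n p X \<sigma> lam \<Delta> Y binit j + \<zeta>)"

definition false_pos :: "nat \<Rightarrow> nat \<Rightarrow> rmat \<Rightarrow> real \<Rightarrow> real \<Rightarrow> rvec \<Rightarrow> real \<Rightarrow> rvec \<Rightarrow> rvec \<Rightarrow> rvec \<Rightarrow> real \<Rightarrow> nat set" where
  "false_pos n p X \<sigma> lam \<Delta> \<zeta> \<beta>0 Y binit \<alpha> =
     {j. j < p \<and> pcorr n p X \<sigma> lam \<Delta> \<zeta> Y binit j \<le> \<alpha> \<and> \<beta>0 j = 0}"

end

theory Submission
  imports Defs
begin

text \<open>
  Write \<open>Z\<close> for the noise part \<open>R X\<^sup>T \<epsilon> / n\<close> of the ridge estimator, where \<open>R\<close> is the ridge resolvent; it has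
  law \<open>N(0, \<sigma>\<^sup>2 \<Omega> / n)\<close>. For a true null \<open>j\<close> the corrected estimator is \<open>Z j\<close>, minus the ridge bias, minus the
  error of the initial estimator. On the event of the hypothesis on the initial estimator, \<open>\<Delta> j\<close>
  absorbs the last term. The scaled bias tends to 0 uniformly in \<open>j\<close>, because the projected
  parameter lies in the row space of \<open>X\<close>, where the spectrum of the Gram matrix is at least its
  smallest nonzero eigenvalue; as \<open>Phi\<close> is Lipschitz, the slack \<open>\<zeta>\<close> eventually absorbs it. So a
  false positive forces \<open>F\<^sub>Z (min-p-value of Z) \<le> \<alpha>\<close>, and \<open>F\<^sub>Z\<close> is exactly the distribution
  function of that minimum, whence the probability is at most \<open>\<alpha>\<close> plus that of the exceptional
  event. The bound is uniform in \<open>\<alpha>\<close>, so \<open>\<eta> = 0\<close> works in the second part.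
\<close>

section \<open>Spectral theorem for symmetric matrices\<close>

text \<open>The law inside \<open>FZ\<close> is the image of p-dimensional standard noise under a
  matrix square root, whereas the ridge noise is the image of n-dimensional noise. For p > n the
  covariance is singular, so the two cannot be compared through densities; they are identified
  through characteristic functions, which see a linear image of Gaussian noise only through the Gram
  matrix of the linear map. The other obstacle is that \<open>minv\<close>, \<open>pinv\<close> and
  \<open>msqrt\<close> are definite descriptions: nothing can be computed from them before existence
  and uniqueness are known. All three existence proofs rest on one spectral theorem, stated for
  functions on pairs of naturals of which only the leading p x p block matters; hence the equalities
  modulo \<open>eq_on\<close>. The same eigenbasis later gives the bias bound.\<close>

definition dot :: "nat \<Rightarrow> rvec \<Rightarrow> rvec \<Rightarrow> real" where
  "dot p v w = (\<Sum>i<p. v i * w i)"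

definition mv :: "nat \<Rightarrow> rmat \<Rightarrow> rvec \<Rightarrow> rvec" where
  "mv p A v = (\<lambda>i. \<Sum>j<p. A i j * v j)"

lemma dot_commute: "dot p v w = dot p w v"
  by (simp add: dot_def mult.commute)

lemma dot_add_left: "dot p (\<lambda>i. v i + w i) x = dot p v x + dot p w x"
  and dot_diff_left: "dot p (\<lambda>i. v i - w i) x = dot p v x - dot p w x"
  and dot_scale_left: "dot p (\<lambda>i. c * v i) x = c * dot p v x"
  and dot_sum_left: "dot p (\<lambda>i. \<Sum>k\<in>K. V k i) x = (\<Sum>k\<in>K. dot p (V k) x)"
  by (simp_all add: dot_def algebra_simps sum.distrib sum_subtractf sum_distrib_left sum.swap[of _ _ K])

lemma dot_add_right: "dot p x (\<lambda>i. v i + w i) = dot p x v + dot p x w"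
  and dot_diff_right: "dot p x (\<lambda>i. v i - w i) = dot p x v - dot p x w"
  and dot_scale_right: "dot p x (\<lambda>i. c * v i) = c * dot p x v"
  and dot_sum_right: "dot p x (\<lambda>i. \<Sum>k\<in>K. V k i) = (\<Sum>k\<in>K. dot p x (V k))"
  by (simp_all add: dot_commute[of p x] dot_add_left dot_diff_left dot_scale_left dot_sum_left)

lemmas dot_linear = dot_add_left dot_diff_left dot_scale_left dot_sum_left
  dot_add_right dot_diff_right dot_scale_right dot_sum_right

lemma dot_cong: "(\<And>i. i < p \<Longrightarrow> v i = v' i) \<Longrightarrow> (\<And>i. i < p \<Longrightarrow> w i = w' i) \<Longrightarrow> dot p v w = dot p v' w'"
  by (simp add: dot_def)

lemma dot_ge_zero [simp]: "0 \<le> dot p v v"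
  by (simp add: dot_def sum_nonneg)

lemma dot_eq_zero_iff: "dot p v v = 0 \<longleftrightarrow> (\<forall>i<p. v i = 0)"
  by (auto simp: dot_def sum_nonneg_eq_0_iff)

lemma dot_zero [simp]: "dot p (\<lambda>i. 0) v = 0" "dot p v (\<lambda>i. 0) = 0"
  by (simp_all add: dot_def)

lemma mv_add: "mv p A (\<lambda>i. v i + w i) = (\<lambda>i. mv p A v i + mv p A w i)"
  and mv_scale: "mv p A (\<lambda>i. c * v i) = (\<lambda>i. c * mv p A v i)"
  and mv_diff: "mv p A (\<lambda>i. v i - w i) = (\<lambda>i. mv p A v i - mv p A w i)"
  by (auto simp: mv_def algebra_simps sum.distrib sum_subtractf sum_distrib_left intro!: ext)

lemma mv_cong: "(\<And>i. i < p \<Longrightarrow> v i = v' i) \<Longrightarrow> mv p A v = mv p A v'"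
  by (simp add: mv_def)

lemma dot_mv_sym:
  assumes "\<And>i j. i < p \<Longrightarrow> j < p \<Longrightarrow> A i j = A j i"
  shows "dot p v (mv p A w) = dot p (mv p A v) w"
proof -
  have "dot p v (mv p A w) = (\<Sum>i<p. \<Sum>j<p. v i * A i j * w j)"
    by (simp add: dot_def mv_def sum_distrib_left mult.assoc)
  also have "\<dots> = (\<Sum>j<p. \<Sum>i<p. A j i * v i * w j)"
    by (subst sum.swap) (auto intro!: sum.cong simp: assms)
  finally show ?thesis
    by (simp add: dot_def mv_def sum_distrib_right)
qed

section \<open>Orthonormal systems and eigenvectors\<close>

definition orthonormal :: "nat \<Rightarrow> nat \<Rightarrow> (nat \<Rightarrow> rvec) \<Rightarrow> bool" where
  "orthonormal p k u \<longleftrightarrow> (\<forall>i<k. \<forall>j<k. dot p (u i) (u j) = (if i = j then 1 else 0))"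

text \<open>\<open>r j\<close> is the j-th standard basis vector minus its projection on the span of
  the \<open>u i\<close>. The squared norms add up to the trace of the complementary projection:
  positive for k < p, which supplies a vector orthogonal to the system, and zero for k = p, which
  gives completeness.\<close>

lemma residual_norm:
  assumes "orthonormal p k u"
  defines "r \<equiv> \<lambda>j l. idm j l - (\<Sum>i<k. u i j * u i l)"
  shows "i < k \<Longrightarrow> dot p (u i) (r j) = 0 \<or> \<not> j < p"
    and "(\<Sum>j<p. dot p (r j) (r j)) = real p - real k"
proof -
  have e: "dot p (idm j) v = v j" "dot p v (idm j) = v j" if "j < p" for j v
    using that by (simp_all add: dot_def idm_def if_distrib if_distribR sum.delta cong: if_cong)
  have o: "dot p (u i) (\<lambda>l. \<Sum>i<k. u i j * u i l) = u i j" if "i < k" for i j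
  proof -
    have "dot p (u i) (\<lambda>l. \<Sum>i<k. u i j * u i l) = (\<Sum>i'<k. if i' = i then u i j else 0)"
      unfolding dot_linear using assms(1) that by (intro sum.cong) (auto simp: orthonormal_def)
    then show ?thesis using that by simp
  qed
  have 1: "dot p (u i) (r j) = 0" if "i < k" "j < p" for i j
    using that unfolding r_def dot_diff_right by (simp add: e o)
  then show "i < k \<Longrightarrow> dot p (u i) (r j) = 0 \<or> \<not> j < p"
    by blast
  have "dot p (r j) (r j) = 1 - (\<Sum>i<k. u i j * u i j)" if "j < p" for j
  proof -
    have "dot p (r j) (r j) = dot p (idm j) (r j) - (\<Sum>i<k. u i j * dot p (u i) (r j))"
      by (subst (1) r_def) (simp add: dot_linear)
    also have "\<dots> = r j j"
      using that by (simp add: e 1)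
    finally show ?thesis by (simp add: r_def idm_def)
  qed
  then have "(\<Sum>j<p. dot p (r j) (r j)) = real p - (\<Sum>i<k. dot p (u i) (u i))"
    by (simp add: sum_subtractf dot_def sum.swap[of _ "{..<p}"])
  also have "(\<Sum>i<k. dot p (u i) (u i)) = real k"
    using assms(1) by (simp add: orthonormal_def)
  finally show "(\<Sum>j<p. dot p (r j) (r j)) = real p - real k" .
qed

text \<open>Vectors are functions on all naturals with the product topology, so compactness comes
  from the Tychonoff cube with sides [-1, 1]. Coordinates from p on are invisible to
  \<open>dot p\<close> and must be fixed to zero for the sphere to lie in the cube.\<close>

lemma compact_unit_sphere_section:
  "compact {v::rvec. (\<forall>i\<ge>p. v i = 0) \<and> dot p v v = 1 \<and> (\<forall>i<k. dot p (u i) v = 0)}" (is "compact ?K")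
proof -
  have c: "compact (PiE UNIV (\<lambda>i::nat. {-1..1::real}))"
  proof -
    have "compactin (product_topology (\<lambda>i::nat. euclidean) UNIV) (PiE UNIV (\<lambda>i. {-1..1::real}))"
      by (subst compactin_PiE) simp
    then show ?thesis
      by (simp only: euclidean_product_topology compactin_euclidean_iff)
  qed
  have "closed (\<Inter>i\<in>{p..}. {v::rvec. v i = 0})"
    by (intro closed_INT ballI closed_Collect_eq continuous_on_product_coordinates continuous_on_const)
  moreover have "closed {v::rvec. dot p v v = 1}"
    unfolding dot_def
    by (intro closed_Collect_eq continuous_intros continuous_on_product_coordinates)
  moreover have "closed (\<Inter>i\<in>{..<k}. {v::rvec. dot p (u i) v = 0})"
    unfolding dot_def
    by (intro closed_INT ballI closed_Collect_eq continuous_intros continuous_on_product_coordinates)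
  ultimately have cl: "closed ((\<Inter>i\<in>{p..}. {v::rvec. v i = 0}) \<inter> {v. dot p v v = 1} \<inter> (\<Inter>i\<in>{..<k}. {v. dot p (u i) v = 0}))"
    by (intro closed_Int)
  have "\<bar>v i\<bar> \<le> 1" if "\<forall>i\<ge>p. v i = 0" "dot p v v = 1" for v :: rvec and i
  proof (cases "i < p")
    case True
    then have "v i * v i \<le> dot p v v"
      unfolding dot_def by (intro member_le_sum) auto
    then have "(v i)\<^sup>2 \<le> 1" using that by (simp add: power2_eq_square)
    then show ?thesis by (simp add: abs_square_le_1)
  qed (use that in auto)
  then have "?K = PiE UNIV (\<lambda>i::nat. {-1..1::real}) \<inter> ((\<Inter>i\<in>{p..}. {v. v i = 0}) \<inter> {v. dot p v v = 1} \<inter> (\<Inter>i\<in>{..<k}. {v. dot p (u i) v = 0}))"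
    by (fastforce simp: abs_le_iff)
  then show ?thesis
    using compact_Int_closed[OF c cl] by simp
qed

text \<open>First-order condition at an extremum: a nonzero linear term would win for some t. The
  test values are the minimiser -b/c for c > 0, and -1 otherwise.\<close>

lemma quadratic_nonneg_imp_zero:
  fixes b c :: real
  assumes "\<And>t. 0 \<le> 2 * t * b + t\<^sup>2 * c" "0 \<le> b"
  shows "b = 0"
proof (rule ccontr)
  assume "b \<noteq> 0"
  with assms(2) have "b > 0" by simp
  show False
  proof (cases "c > 0")
    case True
    have "2 * (- b / c) * b + (- b / c)\<^sup>2 * c = - (b\<^sup>2 / c)"
      using True by (simp add: power2_eq_square field_simps)
    moreover have "b\<^sup>2 / c > 0" using True \<open>b > 0\<close> by simp
    ultimately show False using assms(1)[of "- b / c"] by linarith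
  next
    case False
    then show False using assms(1)[of "-1"] \<open>b > 0\<close> by simp
  qed
qed

text \<open>Rayleigh quotient: a maximiser v over the unit sphere of the complement of the known
  eigenvectors is an eigenvector. A symmetric A maps this complement into itself, so the defect m v
  - A v is an admissible direction of perturbation, and maximality forces it to vanish.\<close>

lemma exists_eigenvector_orthogonal:
  assumes sym: "\<And>i j. i < p \<Longrightarrow> j < p \<Longrightarrow> A i j = A j i"
    and on: "orthonormal p k u" and "k < p"
    and eig: "\<And>i j. i < k \<Longrightarrow> j < p \<Longrightarrow> mv p A (u i) j = d i * u i j"
  obtains v m where "dot p v v = 1" "\<And>i. i < k \<Longrightarrow> dot p (u i) v = 0" "\<And>i. i < p \<Longrightarrow> mv p A v i = m * v i"
proof -
  let ?K = "{v::rvec. (\<forall>i\<ge>p. v i = 0) \<and> dot p v v = 1 \<and> (\<forall>i<k. dot p (u i) v = 0)}"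
  have normalize: "(\<lambda>i. if i < p then w i / sqrt (dot p w w) else 0) \<in> ?K"
    if "dot p w w \<noteq> 0" "\<And>i. i < k \<Longrightarrow> dot p (u i) w = 0" for w
  proof -
    have "dot p x (\<lambda>i. if i < p then w i / sqrt (dot p w w) else 0) = dot p x w / sqrt (dot p w w)" for x
      by (simp add: dot_def sum_divide_distrib)
    moreover have "dot p (\<lambda>i. if i < p then w i / sqrt (dot p w w) else 0) w = dot p w w / sqrt (dot p w w)"
      by (simp add: dot_def sum_divide_distrib)
    ultimately show ?thesis
      using that by (simp add: real_div_sqrt)
  qed
  have ne: "S \<noteq> {}" if "x \<in> S" for x :: rvec and S
    using that by auto
  have "?K \<noteq> {}"
  proof -
    define r where "r = (\<lambda>j l. idm j l - (\<Sum>i<k. u i j * u i l))"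
    have "(\<Sum>j<p. dot p (r j) (r j)) > 0"
      using residual_norm(2)[OF on] \<open>k < p\<close> by (simp add: r_def)
    then obtain j where "j < p" "dot p (r j) (r j) \<noteq> 0"
      by (metis (no_types, lifting) lessThan_iff less_irrefl sum.neutral)
    moreover have "dot p (u i) (r j) = 0" if "i < k" for i
      using residual_norm(1)[OF on that, of j] \<open>j < p\<close> by (simp add: r_def)
    ultimately have "(\<lambda>i. if i < p then r j i / sqrt (dot p (r j) (r j)) else 0) \<in> ?K"
      by (intro normalize)
    then show ?thesis
      by (rule ne)
  qed
  moreover have "continuous_on UNIV (\<lambda>v. dot p v (mv p A v))"
    unfolding dot_def mv_def
    by (intro continuous_intros continuous_on_product_coordinates)
  then have "continuous_on ?K (\<lambda>v. dot p v (mv p A v))"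
    by (rule continuous_on_subset) simp
  ultimately have "\<exists>v\<in>?K. \<forall>w\<in>?K. dot p w (mv p A w) \<le> dot p v (mv p A v)"
    by (intro continuous_attains_sup compact_unit_sphere_section)
  then obtain v where v: "v \<in> ?K" and max: "\<And>w. w \<in> ?K \<Longrightarrow> dot p w (mv p A w) \<le> dot p v (mv p A v)"
    by (elim bexE) (rule that, assumption, drule bspec)
  define m where "m = dot p v (mv p A v)"
  have Q: "dot p w (mv p A w) \<le> m * dot p w w" if "\<And>i. i < k \<Longrightarrow> dot p (u i) w = 0" for w
  proof (cases "dot p w w = 0")
    case True
    then have "\<forall>i<p. w i = 0" by (simp add: dot_eq_zero_iff)
    then show ?thesis by (simp add: dot_def)
  next
    case False
    let ?w = "\<lambda>i. if i < p then w i / sqrt (dot p w w) else 0"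
    have "dot p ?w (mv p A ?w) = dot p (\<lambda>i. 1 / sqrt (dot p w w) * w i) (mv p A (\<lambda>i. 1 / sqrt (dot p w w) * w i))"
      by (simp add: dot_def mv_def)
    also have "\<dots> = dot p w (mv p A w) / dot p w w"
      unfolding mv_scale dot_linear by simp
    finally have "dot p w (mv p A w) / dot p w w \<le> m"
      using max[OF normalize[OF False that]] by (simp add: m_def)
    then show ?thesis
      using False dot_ge_zero[of p w] by (simp add: divide_le_eq)
  qed
  define r where "r = (\<lambda>i. m * v i - mv p A v i)"
  have ur: "dot p (u i) r = 0" if "i < k" for i
  proof -
    have "dot p (u i) (mv p A v) = dot p (mv p A (u i)) v"
      by (rule dot_mv_sym) (rule sym)
    also have "\<dots> = dot p (\<lambda>j. d i * u i j) v"
      by (rule dot_cong) (auto simp: eig that)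
    finally show ?thesis
      using v that by (simp add: r_def dot_linear)
  qed
  define c where "c = m * dot p r r - dot p r (mv p A r)"
  \<comment> \<open>For w = v + t r, the difference m <w,w> - <w,Aw> expands to 2 t <r,r> + t^2 c
    because r = m v - A v; it is nonnegative since m is the maximum.\<close>
  have "2 * t * dot p r r + t\<^sup>2 * c \<ge> 0" for t
  proof -
    let ?w = "\<lambda>i. v i + t * r i"
    have rA: "dot p v (mv p A r) = dot p r (mv p A v)"
      using dot_mv_sym[of p A v r] sym by (simp add: dot_commute)
    have "dot p ?w (mv p A ?w) \<le> m * dot p ?w ?w"
      using v ur by (intro Q) (simp add: dot_linear)
    moreover have "dot p ?w (mv p A ?w) = m + 2 * t * dot p r (mv p A v) + t\<^sup>2 * dot p r (mv p A r)"
      by (simp add: mv_add mv_scale dot_linear rA m_def power2_eq_square algebra_simps)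
    moreover have "dot p ?w ?w = 1 + 2 * t * dot p r v + t\<^sup>2 * dot p r r"
      using v by (simp add: dot_linear dot_commute[of p v r] power2_eq_square algebra_simps)
    moreover have "dot p r r = m * dot p r v - dot p r (mv p A v)"
      by (subst (2) r_def) (simp add: dot_linear)
    ultimately have "m + 2 * t * dot p r (mv p A v) + t\<^sup>2 * dot p r (mv p A r) \<le> m * (1 + 2 * t * dot p r v + t\<^sup>2 * dot p r r)"
      and "2 * t * dot p r r = 2 * t * (m * dot p r v - dot p r (mv p A v))"
      by simp_all
    then show ?thesis
      unfolding c_def right_diff_distrib distrib_left by (simp add: mult.left_commute mult.assoc)
  qed
  then have "dot p r r = 0"
    by (intro quadratic_nonneg_imp_zero) auto
  then have "mv p A v i = m * v i" if "i < p" for i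
    using that by (simp add: dot_eq_zero_iff r_def)
  then show ?thesis
    using v by (intro that[of v m]) auto
qed

theorem spectral_decomposition:
  assumes sym: "\<And>i j. i < p \<Longrightarrow> j < p \<Longrightarrow> A i j = A j i"
  obtains u d where "orthonormal p p u" "\<And>i j. i < p \<Longrightarrow> j < p \<Longrightarrow> mv p A (u i) j = d i * u i j"
proof -
  have "\<exists>u d. orthonormal p k u \<and> (\<forall>i<k. \<forall>j<p. mv p A (u i) j = d i * u i j)" if "k \<le> p" for k
    using that
  proof (induction k)
    case 0
    then show ?case by (simp add: orthonormal_def)
  next
    case (Suc k)
    then obtain u d where on: "orthonormal p k u" and e: "\<And>i j. i < k \<Longrightarrow> j < p \<Longrightarrow> mv p A (u i) j = d i * u i j"
      by auto
    from Suc.prems have "k < p" by simp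
    from exists_eigenvector_orthogonal[OF sym on this e] obtain v m where
      v: "dot p v v = 1" "\<And>i. i < k \<Longrightarrow> dot p (u i) v = 0" "\<And>i. i < p \<Longrightarrow> mv p A v i = m * v i"
      by metis
    have "orthonormal p (Suc k) (u(k := v))"
      using on v dot_commute[of p v "u i" for i] by (auto simp: orthonormal_def less_Suc_eq)
    moreover have "\<forall>i<Suc k. \<forall>j<p. mv p A ((u(k := v)) i) j = (d(k := m)) i * (u(k := v)) i j"
      using e v by (auto simp: less_Suc_eq)
    ultimately show ?case by blast
  qed
  from this[of p] that show ?thesis by auto
qed

text \<open>With k = p the residuals of all basis vectors have total squared norm p - p = 0, so each
  of them vanishes: orthonormal rows have orthonormal columns.\<close>

lemma orthonormal_complete:
  assumes "orthonormal p p u" "j < p" "l < p"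
  shows "(\<Sum>i<p. u i j * u i l) = (if j = l then 1 else 0)"
proof -
  define r where "r = (\<lambda>j l. idm j l - (\<Sum>i<p. u i j * u i l))"
  have "(\<Sum>j<p. dot p (r j) (r j)) = 0"
    using residual_norm(2)[OF assms(1)] by (simp add: r_def)
  then have "dot p (r j) (r j) = 0"
    using assms(2) by (simp add: sum_nonneg_eq_0_iff)
  then show ?thesis
    using assms(3) by (auto simp: dot_eq_zero_iff r_def idm_def split: if_splits)
qed

section \<open>Inverse, pseudo-inverse and square root\<close>

lemma mmul_assoc: "mmul k (mmul l A B) C = mmul l A (mmul k B C)"
proof (intro ext)
  fix i j
  have "mmul k (mmul l A B) C i j = (\<Sum>x<k. \<Sum>y<l. A i y * B y x * C x j)"
    by (simp add: mmul_def sum_distrib_right)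
  also have "\<dots> = (\<Sum>y<l. \<Sum>x<k. A i y * B y x * C x j)"
    by (rule sum.swap)
  also have "\<dots> = mmul l A (mmul k B C) i j"
    by (simp add: mmul_def sum_distrib_left mult.assoc)
  finally show "mmul k (mmul l A B) C i j = mmul l A (mmul k B C) i j" .
qed

lemma mtr_mmul: "mtr (mmul k A B) = mmul k (mtr B) (mtr A)"
  by (simp add: mtr_def mmul_def mult.commute)

lemma mtr_mtr [simp]: "mtr (mtr A) = A"
  by (simp add: mtr_def)

lemma eq_on_refl [simp]: "eq_on m q A A"
  by (simp add: eq_on_def)

lemma eq_on_sym: "eq_on m q A B \<Longrightarrow> eq_on m q B A"
  by (simp add: eq_on_def)

lemma eq_on_trans [trans]: "eq_on m q A B \<Longrightarrow> eq_on m q B C \<Longrightarrow> eq_on m q A C"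
  by (simp add: eq_on_def)

lemma eq_on_mtr: "eq_on m q A B \<Longrightarrow> eq_on q m (mtr A) (mtr B)"
  by (simp add: eq_on_def mtr_def)

lemma eq_on_mmul: "eq_on m k A A' \<Longrightarrow> eq_on k q B B' \<Longrightarrow> eq_on m q (mmul k A B) (mmul k A' B')"
  by (auto simp: eq_on_def mmul_def intro!: sum.cong)

lemma eq_on_mmul_idm: "eq_on m q (mmul m idm B) B" "eq_on m q (mmul q B idm) B"
  by (simp_all add: eq_on_def mmul_def idm_def if_distrib if_distribR sum.delta cong: if_cong)

lemma zero_outside_eqI: "zero_outside m q A \<Longrightarrow> zero_outside m q B \<Longrightarrow> eq_on m q A B \<Longrightarrow> A = B"
  unfolding zero_outside_def eq_on_def by (intro ext) (metis not_le)

text \<open>Cancellation C = C A B = B. The condition \<open>zero_outside\<close> pins the entries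
  beyond dimension p, which makes the inverse unique as a function and not merely on the
  block.\<close>

lemma minv_eqI:
  assumes B: "zero_outside p p B" "eq_on p p (mmul p A B) idm" "eq_on p p (mmul p B A) idm"
  shows "minv p A = B"
  unfolding minv_def
proof (rule the_equality)
  fix C assume C: "zero_outside p p C \<and> eq_on p p (mmul p A C) idm \<and> eq_on p p (mmul p C A) idm"
  have "eq_on p p C (mmul p C idm)"
    by (intro eq_on_sym[OF eq_on_mmul_idm(2)])
  also have "eq_on p p \<dots> (mmul p C (mmul p A B))"
    using B by (intro eq_on_mmul eq_on_refl eq_on_sym[of _ _ "mmul p A B"])
  also have "eq_on p p \<dots> (mmul p idm B)"
    unfolding mmul_assoc[symmetric] using C by (intro eq_on_mmul eq_on_refl) auto
  also have "eq_on p p \<dots> B"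
    by (rule eq_on_mmul_idm)
  finally show "C = B"
    using B C by (intro zero_outside_eqI) auto
qed (use B in auto)

section \<open>Moore-Penrose inverses\<close>

definition penrose :: "nat \<Rightarrow> nat \<Rightarrow> rmat \<Rightarrow> rmat \<Rightarrow> bool" where
  "penrose m q A B \<longleftrightarrow> zero_outside q m B
      \<and> eq_on m q (mmul m (mmul q A B) A) A
      \<and> eq_on q m (mmul q (mmul m B A) B) B
      \<and> eq_on m m (mtr (mmul q A B)) (mmul q A B)
      \<and> eq_on q q (mtr (mmul m B A)) (mmul m B A)"

text \<open>The two projections agree first: AB = (AC)(AB) = (AC)^T (AB)^T = (ABAC)^T = (AC)^T = AC,
  and likewise BA = CA. Then B = BAB = CAB = CAC = C.\<close>

lemma penrose_unique:
  assumes B: "penrose m q A B" and C: "penrose m q A C"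
  shows "B = C"
proof -
  note b = B[unfolded penrose_def] and c = C[unfolded penrose_def]
  have "eq_on m m (mmul q A B) (mmul q (mmul m (mmul q A C) A) B)"
    using c by (intro eq_on_mmul eq_on_refl) (auto intro: eq_on_sym)
  also have "\<dots> = mmul m (mmul q A C) (mmul q A B)"
    by (simp only: mmul_assoc)
  also have "eq_on m m \<dots> (mmul m (mtr (mmul q A C)) (mtr (mmul q A B)))"
    using b c by (intro eq_on_mmul) (auto intro: eq_on_sym)
  also have "\<dots> = mtr (mmul q (mmul m (mmul q A B) A) C)"
    by (simp add: mtr_mmul mmul_assoc)
  also have "eq_on m m \<dots> (mtr (mmul q A C))"
    using b by (intro eq_on_mtr eq_on_mmul) auto
  also have "eq_on m m \<dots> (mmul q A C)"
    using c by auto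
  finally have AB: "eq_on m m (mmul q A B) (mmul q A C)" .
  have "eq_on q q (mmul m B A) (mmul m B (mmul m (mmul q A C) A))"
    using c by (intro eq_on_mmul eq_on_refl) (auto intro: eq_on_sym)
  also have "\<dots> = mmul q (mmul m B A) (mmul m C A)"
    by (simp only: mmul_assoc)
  also have "eq_on q q \<dots> (mmul q (mtr (mmul m B A)) (mtr (mmul m C A)))"
    using b c by (intro eq_on_mmul) (auto intro: eq_on_sym)
  also have "\<dots> = mtr (mmul m C (mmul m (mmul q A B) A))"
    by (simp add: mtr_mmul mmul_assoc)
  also have "eq_on q q \<dots> (mtr (mmul m C A))"
    using b by (intro eq_on_mtr eq_on_mmul) auto
  also have "eq_on q q \<dots> (mmul m C A)"
    using c by auto
  finally have BA: "eq_on q q (mmul m B A) (mmul m C A)" .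
  have "eq_on q m B (mmul q (mmul m B A) B)"
    using b by (auto intro: eq_on_sym)
  also have "eq_on q m \<dots> (mmul q (mmul m C A) B)"
    by (rule eq_on_mmul[OF BA eq_on_refl])
  also have "\<dots> = mmul m C (mmul q A B)"
    by (rule mmul_assoc)
  also have "eq_on q m \<dots> (mmul m C (mmul q A C))"
    by (rule eq_on_mmul[OF eq_on_refl AB])
  also have "\<dots> = mmul q (mmul m C A) C"
    by (rule mmul_assoc[symmetric])
  also have "eq_on q m \<dots> C"
    using c by auto
  finally show ?thesis
    using b c by (intro zero_outside_eqI) auto
qed

lemma penrose_pinv:
  assumes "penrose m q A B"
  shows "penrose m q A (pinv m q A)"
proof -
  have "pinv m q A = (THE B. penrose m q A B)"
    by (simp add: pinv_def penrose_def)
  also have "\<dots> = B"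
    using assms penrose_unique by blast
  finally show ?thesis
    using assms by simp
qed

text \<open>For \<open>A = smat p u d\<close> with orthonormal \<open>u\<close>, functions of \<open>A\<close> act on the coefficients \<open>d\<close>.\<close>

definition smat :: "nat \<Rightarrow> (nat \<Rightarrow> rvec) \<Rightarrow> (nat \<Rightarrow> real) \<Rightarrow> rmat" where
  "smat p u c = (\<lambda>i j. if i < p \<and> j < p then \<Sum>k<p. c k * u k i * u k j else 0)"

lemma zero_outside_smat [simp]: "zero_outside p p (smat p u c)"
  by (simp add: zero_outside_def smat_def)

lemma smat_sym: "smat p u c i j = smat p u c j i"
  by (simp add: smat_def mult.assoc mult.left_commute mult.commute)

lemma mtr_smat [simp]: "mtr (smat p u c) = smat p u c"
  by (intro ext) (simp add: mtr_def smat_sym)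

text \<open>The cross terms carry the inner products of \<open>u k\<close> and \<open>u k'\<close>,
  so only the diagonal survives and matrix products become products of coefficients.\<close>

lemma smat_mmul:
  assumes "orthonormal p p u"
  shows "mmul p (smat p u c) (smat p u c') = smat p u (\<lambda>k. c k * c' k)"
proof (intro ext)
  fix i j
  show "mmul p (smat p u c) (smat p u c') i j = smat p u (\<lambda>k. c k * c' k) i j"
  proof (cases "i < p \<and> j < p")
    case True
    then have "mmul p (smat p u c) (smat p u c') i j
        = (\<Sum>l<p. \<Sum>k<p. \<Sum>k'<p. (c k * u k i * c' k' * u k' j) * (u k l * u k' l))"
      by (simp add: mmul_def smat_def sum_product mult_ac)
    also have "\<dots> = (\<Sum>k<p. \<Sum>k'<p. (c k * u k i * c' k' * u k' j) * dot p (u k) (u k'))"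
      unfolding dot_def sum_distrib_left
      by (subst sum.swap, rule sum.cong[OF refl], subst sum.swap) simp
    also have "\<dots> = (\<Sum>k<p. \<Sum>k'<p. if k = k' then c k * u k i * c' k * u k j else 0)"
      using assms by (intro sum.cong refl) (auto simp: orthonormal_def)
    finally show ?thesis
      using True by (simp add: smat_def mult_ac)
  qed (auto simp: mmul_def smat_def)
qed

lemma smat_one: "orthonormal p p u \<Longrightarrow> eq_on p p (smat p u (\<lambda>_. 1)) idm"
  by (simp add: eq_on_def smat_def orthonormal_complete idm_def)

text \<open>Inserting the completeness relation between A and its column index turns A into the sum
  of (A u_i) u_i^T.\<close>

lemma eq_on_smat:
  assumes "orthonormal p p u" "\<And>i j. i < p \<Longrightarrow> j < p \<Longrightarrow> mv p A (u i) j = d i * u i j"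
  shows "eq_on p p A (smat p u d)"
proof -
  have "A j l = smat p u d j l" if "j < p" "l < p" for j l
  proof -
    have "A j l = (\<Sum>m<p. A j m * (if m = l then 1 else 0))"
      using that by (simp add: if_distrib cong: if_cong)
    also have "\<dots> = (\<Sum>m<p. A j m * (\<Sum>i<p. u i m * u i l))"
      using assms(1) that by (intro sum.cong refl) (simp add: orthonormal_complete)
    also have "\<dots> = (\<Sum>i<p. mv p A (u i) j * u i l)"
      unfolding mv_def sum_distrib_left sum_distrib_right by (subst sum.swap) (simp add: mult.assoc)
    finally show ?thesis
      using assms(2) that by (simp add: smat_def)
  qed
  then show ?thesis by (simp add: eq_on_def)
qed

lemma mv_eq_on: "eq_on p p A B \<Longrightarrow> i < p \<Longrightarrow> mv p A v i = mv p B v i"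
  by (simp add: eq_on_def mv_def)

lemma mv_mmul: "mv q (mmul k A B) v = mv k A (mv q B v)"
  by (rule ext) (simp add: mv_def mmul_def sum_distrib_left sum_distrib_right mult.assoc sum.swap[of _ "{..<q}"])

lemma mv_smat: "i < p \<Longrightarrow> mv p (smat p u c) v i = (\<Sum>k<p. c k * dot p (u k) v * u k i)"
proof -
  assume "i < p"
  then have "mv p (smat p u c) v i = (\<Sum>j<p. \<Sum>k<p. c k * u k i * u k j * v j)"
    by (simp add: mv_def smat_def sum_distrib_right)
  also have "\<dots> = (\<Sum>k<p. \<Sum>j<p. c k * u k i * u k j * v j)"
    by (rule sum.swap)
  finally show ?thesis
    by (simp add: dot_def sum_distrib_left sum_distrib_right mult_ac)
qed

lemma parseval:
  assumes "orthonormal p p u"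
  shows "(\<Sum>k<p. (dot p (u k) v)\<^sup>2) = dot p v v"
proof -
  have "dot p v v = dot p v (mv p (smat p u (\<lambda>_. 1)) v)"
    by (rule dot_cong) (simp_all add: mv_eq_on[OF smat_one[OF assms]],
        simp add: mv_def idm_def if_distrib if_distribR sum.delta cong: if_cong)
  also have "\<dots> = dot p v (\<lambda>i. \<Sum>k<p. dot p (u k) v * u k i)"
    by (rule dot_cong) (simp_all add: mv_smat)
  finally show ?thesis
    by (simp add: dot_linear dot_commute[of p v "u k" for k] power2_eq_square)
qed

lemma minv_smat:
  assumes "orthonormal p p u" "eq_on p p A (smat p u c)" "\<And>k. k < p \<Longrightarrow> c k \<noteq> 0"
  shows "minv p A = smat p u (\<lambda>k. 1 / c k)"
proof (rule minv_eqI)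
  have 1: "smat p u (\<lambda>k. c k * (1 / c k)) = smat p u (\<lambda>_. 1)" "smat p u (\<lambda>k. 1 / c k * c k) = smat p u (\<lambda>_. 1)"
    using assms(3) by (auto simp: smat_def intro!: ext sum.cong)
  have "eq_on p p (mmul p A (smat p u (\<lambda>k. 1 / c k))) (smat p u (\<lambda>_. 1))"
    unfolding 1(1)[symmetric] smat_mmul[OF assms(1), symmetric] by (intro eq_on_mmul assms(2) eq_on_refl)
  then show "eq_on p p (mmul p A (smat p u (\<lambda>k. 1 / c k))) idm"
    by (rule eq_on_trans) (rule smat_one[OF assms(1)])
  have "eq_on p p (mmul p (smat p u (\<lambda>k. 1 / c k)) A) (smat p u (\<lambda>_. 1))"
    unfolding 1(2)[symmetric] smat_mmul[OF assms(1), symmetric] by (intro eq_on_mmul assms(2) eq_on_refl)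
  then show "eq_on p p (mmul p (smat p u (\<lambda>k. 1 / c k)) A) idm"
    by (rule eq_on_trans) (rule smat_one[OF assms(1)])
qed simp

text \<open>Zero eigenvalues need no case distinction, since \<open>inverse 0 = 0\<close>.\<close>

lemma penrose_smat:
  assumes "orthonormal p p u" "eq_on p p A (smat p u c)"
  shows "penrose p p A (smat p u (\<lambda>k. inverse (c k)))"
proof -
  let ?B = "smat p u (\<lambda>k. inverse (c k))"
  note sm = smat_mmul[OF assms(1)]
  have AB: "eq_on p p (mmul p A ?B) (smat p u (\<lambda>k. c k * inverse (c k)))"
    unfolding sm[symmetric] by (intro eq_on_mmul assms(2) eq_on_refl)
  have BA: "eq_on p p (mmul p ?B A) (smat p u (\<lambda>k. inverse (c k) * c k))"
    unfolding sm[symmetric] by (intro eq_on_mmul assms(2) eq_on_refl)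
  have ABA: "eq_on p p (mmul p (mmul p A ?B) A) (smat p u (\<lambda>k. c k * inverse (c k) * c k))"
    unfolding sm[of "\<lambda>k. c k * inverse (c k)", symmetric] by (intro eq_on_mmul assms(2) AB)
  have BAB: "eq_on p p (mmul p (mmul p ?B A) ?B) (smat p u (\<lambda>k. inverse (c k) * c k * inverse (c k)))"
    unfolding sm[of "\<lambda>k. inverse (c k) * c k", symmetric] by (intro eq_on_mmul eq_on_refl BA)
  have "c k * inverse (c k) * c k = c k" "inverse (c k) * c k * inverse (c k) = inverse (c k)" for k
    by (cases "c k = 0"; simp)+
  with ABA BAB have "eq_on p p (mmul p (mmul p A ?B) A) A" "eq_on p p (mmul p (mmul p ?B A) ?B) ?B"
    using eq_on_sym[OF assms(2)] by (auto intro: eq_on_trans)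
  moreover have "eq_on p p (mtr (mmul p A ?B)) (mmul p A ?B)"
    using eq_on_mtr[OF AB] eq_on_sym[OF AB] by (auto intro: eq_on_trans)
  moreover have "eq_on p p (mtr (mmul p ?B A)) (mmul p ?B A)"
    using eq_on_mtr[OF BA] eq_on_sym[OF BA] by (auto intro: eq_on_trans)
  ultimately show ?thesis
    by (simp add: penrose_def)
qed

text \<open>The Penrose equations of \<open>pinv\<close> become available only through some existing
  Penrose inverse; inverting the nonzero eigenvalues provides one. Symmetric matrices suffice
  because \<open>PX\<close> takes the pseudo-inverse of X X^T.\<close>

lemma penrose_pinv_sym:
  assumes "\<And>i j. i < p \<Longrightarrow> j < p \<Longrightarrow> A i j = A j i"
  shows "penrose p p A (pinv p p A)"
proof -
  obtain u d where "orthonormal p p u" "\<And>i j. i < p \<Longrightarrow> j < p \<Longrightarrow> mv p A (u i) j = d i * u i j"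
    using spectral_decomposition[of p A] assms by metis
  then show ?thesis
    using penrose_pinv penrose_smat eq_on_smat by blast
qed

section \<open>Square roots of Gram matrices\<close>

lemma quadform_eq_dot: "(\<Sum>i<p. \<Sum>j<p. v i * S i j * v j) = dot p v (mv p S v)"
  by (simp add: dot_def mv_def sum_distrib_left mult.assoc)

text \<open>It is enough that S acts correctly on each eigenvector u of C. The vector w = S u - sqrt
  c u satisfies S w = - sqrt c w, as S S u = c u; for c > 0 this contradicts positivity of S unless
  w = 0. For c = 0, |S u|^2 = <u, S S u> = 0.\<close>

lemma psd_sqrt_unique:
  assumes "orthonormal p p u" "eq_on p p C (smat p u c)" "\<And>k. k < p \<Longrightarrow> 0 \<le> c k"
    and S: "zero_outside p p S" "eq_on p p (mtr S) S" "\<And>v. 0 \<le> dot p v (mv p S v)"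
      "eq_on p p (mmul p S S) C"
  shows "S = smat p u (\<lambda>k. sqrt (c k))"
proof (rule zero_outside_eqI[OF S(1)])
  have Ssym: "S i j = S j i" if "i < p" "j < p" for i j
    using S(2) that by (auto simp: eq_on_def mtr_def)
  show "eq_on p p S (smat p u (\<lambda>k. sqrt (c k)))"
  proof (rule eq_on_smat[OF assms(1)])
    fix k j assume kj: "k < p" "j < p"
    define w where "w = (\<lambda>i. mv p S (u k) i - sqrt (c k) * u k i)"
    have SS: "mv p S (mv p S (u k)) i = c k * u k i" if "i < p" for i
    proof -
      have "mv p S (mv p S (u k)) i = mv p (smat p u c) (u k) i"
        unfolding mv_mmul[symmetric] by (rule mv_eq_on[OF eq_on_trans[OF S(4) assms(2)] that])
      also have "\<dots> = (\<Sum>l<p. if l = k then c k * u k i else 0)"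
        unfolding mv_smat[OF that] using assms(1) kj by (intro sum.cong) (auto simp: orthonormal_def)
      finally show ?thesis using kj by simp
    qed
    have "dot p w w = 0"
    proof (cases "c k = 0")
      case True
      have "dot p w w = dot p (u k) (mv p S (mv p S (u k)))"
        using dot_mv_sym[of p S "u k" "mv p S (u k)"] Ssym by (simp add: True w_def)
      also have "\<dots> = dot p (u k) (\<lambda>i. 0)"
        by (rule dot_cong) (simp_all add: SS True)
      finally show ?thesis by simp
    next
      case False
      then have "sqrt (c k) > 0" using assms(3)[OF kj(1)] by simp
      have "mv p S w i = - sqrt (c k) * w i" if "i < p" for i
        using assms(3)[OF kj(1)] unfolding w_def mv_diff mv_scale
        by (simp add: SS that algebra_simps flip: mult.assoc)
      then have "dot p w (mv p S w) = dot p w (\<lambda>i. - sqrt (c k) * w i)"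
        by (intro dot_cong) auto
      then have "dot p w (mv p S w) = - sqrt (c k) * dot p w w"
        by (simp only: dot_linear)
      with S(3)[of w] \<open>sqrt (c k) > 0\<close> show ?thesis
        using dot_ge_zero[of p w] by (simp add: mult_le_0_iff)
    qed
    then show "mv p S (u k) j = sqrt (c k) * u k j"
      using kj by (simp add: dot_eq_zero_iff w_def)
  qed
qed simp

text \<open>Positive semidefiniteness enters in the form C = A A^T, which is how covariances of
  linear noise arise; it makes the eigenvalues nonnegative, so that their roots give the matrix
  denoted by \<open>msqrt\<close>. Only the Gram matrix of the root is recorded, since the
  characteristic function depends on nothing else.\<close>

lemma msqrt_gram:
  assumes gram: "\<And>i j. i < p \<Longrightarrow> j < p \<Longrightarrow> C i j = (\<Sum>l<m. A i l * A j l)"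
    and "i < p" "j < p"
  shows "(\<Sum>k<p. msqrt p C i k * msqrt p C j k) = C i j"
proof -
  have "C i j = C j i" if "i < p" "j < p" for i j
    using that by (simp add: gram mult.commute)
  then obtain u d where u: "orthonormal p p u" and e: "\<And>i j. i < p \<Longrightarrow> j < p \<Longrightarrow> mv p C (u i) j = d i * u i j"
    using spectral_decomposition[of p C] by metis
  have C: "eq_on p p C (smat p u d)"
    by (rule eq_on_smat[OF u e])
  have psd: "0 \<le> dot p v (mv p C v)" for v
  proof -
    have "dot p v (mv p C v) = (\<Sum>i<p. \<Sum>j<p. \<Sum>l<m. (v i * A i l) * (v j * A j l))"
      unfolding quadform_eq_dot[symmetric] by (intro sum.cong refl) (simp add: gram sum_distrib_left sum_distrib_right mult_ac)
    also have "\<dots> = (\<Sum>l<m. (\<Sum>i<p. v i * A i l) * (\<Sum>j<p. v j * A j l))"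
      by (simp add: sum_product sum.swap[of _ "{..<m}"])
    finally show ?thesis
      by (simp add: sum_nonneg)
  qed
  have d: "0 \<le> d k" if "k < p" for k
  proof -
    have "dot p (u k) (mv p C (u k)) = dot p (u k) (\<lambda>j. d k * u k j)"
      by (rule dot_cong) (simp_all add: e that)
    also have "\<dots> = d k"
      using u that by (simp add: dot_linear orthonormal_def)
    finally show ?thesis using psd[of "u k"] by simp
  qed
  let ?S = "smat p u (\<lambda>k. sqrt (d k))"
  have SS: "eq_on p p (mmul p ?S ?S) C"
  proof -
    have "smat p u (\<lambda>k. sqrt (d k) * sqrt (d k)) = smat p u d"
      using d by (auto simp: smat_def intro!: ext)
    then show ?thesis
      unfolding smat_mmul[OF u] using eq_on_sym[OF C] by simp
  qed
  have Spsd: "0 \<le> dot p v (mv p ?S v)" for v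
  proof -
    have "dot p v (mv p ?S v) = dot p v (\<lambda>i. \<Sum>k<p. sqrt (d k) * dot p (u k) v * u k i)"
      by (rule dot_cong) (simp_all add: mv_smat)
    also have "\<dots> = (\<Sum>k<p. sqrt (d k) * (dot p (u k) v)\<^sup>2)"
      by (simp add: dot_linear dot_commute[of p v "u k" for k] power2_eq_square mult.assoc)
    also have "\<dots> \<ge> 0"
      using d by (intro sum_nonneg) auto
    finally show ?thesis .
  qed
  have "msqrt p C = ?S"
    unfolding msqrt_def quadform_eq_dot
    by (rule the_equality) (use SS Spsd in simp, rule psd_sqrt_unique[OF u C d], auto)
  then have "(\<Sum>k<p. msqrt p C i k * msqrt p C j k) = mmul p ?S ?S i j"
    by (simp add: mmul_def smat_sym[of p u _ _ j])
  then show ?thesis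
    using SS assms(2,3) by (simp add: eq_on_def)
qed

section \<open>Ridge estimator\<close>

lemma mv_idm: "i < p \<Longrightarrow> mv p idm v i = v i"
  by (simp add: mv_def idm_def if_distrib if_distribR cong: if_cong)

lemma mv_Sigma_hat: "mv p (Sigma_hat n X) v i = (\<Sum>l<n. X l i * mv p X v l) / real n"
proof -
  have "mv p (Sigma_hat n X) v i = (\<Sum>j<p. \<Sum>l<n. X l i * X l j * v j) / real n"
    by (simp add: mv_def Sigma_hat_def sum_distrib_right sum_divide_distrib)
  also have "(\<Sum>j<p. \<Sum>l<n. X l i * X l j * v j) = (\<Sum>l<n. \<Sum>j<p. X l i * X l j * v j)"
    by (rule sum.swap)
  finally show ?thesis
    by (simp add: mv_def sum_distrib_left mult.assoc)
qed

lemma Sigma_hat_quadform: "dot p v (mv p (Sigma_hat n X) v) = dot n (mv p X v) (mv p X v) / real n"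
proof -
  have "dot p v (mv p (Sigma_hat n X) v) = (\<Sum>i<p. \<Sum>l<n. v i * X l i * mv p X v l) / real n"
    by (simp add: dot_def mv_Sigma_hat sum_distrib_left sum_divide_distrib mult.assoc)
  also have "(\<Sum>i<p. \<Sum>l<n. v i * X l i * mv p X v l) = (\<Sum>l<n. \<Sum>i<p. v i * X l i * mv p X v l)"
    by (rule sum.swap)
  also have "\<dots> = dot n (mv p X v) (mv p X v)"
    by (simp add: dot_def mv_def[of p X v] sum_distrib_right mult_ac)
  finally show ?thesis .
qed

text \<open>One eigenbasis of \<open>Sigma_hat\<close> serves the resolvent too. The quadratic form
  is |X v|^2 / n, so the eigenvalues are nonnegative and adding \<open>lam\<close> > 0 makes all of
  them invertible.\<close>

lemma ridge_spectral:
  assumes "0 < lam"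
  obtains u d where "orthonormal p p u" "eq_on p p (Sigma_hat n X) (smat p u d)"
    "\<And>k. k < p \<Longrightarrow> 0 \<le> d k" "ridge_res n p X lam = smat p u (\<lambda>k. 1 / (d k + lam))"
    "\<And>k j. k < p \<Longrightarrow> j < p \<Longrightarrow> mv p (Sigma_hat n X) (u k) j = d k * u k j"
proof -
  have "Sigma_hat n X i j = Sigma_hat n X j i" for i j
    by (simp add: Sigma_hat_def mult.commute)
  then obtain u d where u: "orthonormal p p u"
    and e: "\<And>i j. i < p \<Longrightarrow> j < p \<Longrightarrow> mv p (Sigma_hat n X) (u i) j = d i * u i j"
    using spectral_decomposition[of p "Sigma_hat n X"] by metis
  have d: "0 \<le> d k" if "k < p" for k
  proof -
    have "dot p (u k) (mv p (Sigma_hat n X) (u k)) = dot p (u k) (\<lambda>j. d k * u k j)"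
      by (rule dot_cong) (simp_all add: e that)
    also have "\<dots> = d k"
      using u that by (simp add: dot_linear orthonormal_def)
    finally have "d k = dot n (mv p X (u k)) (mv p X (u k)) / real n"
      by (simp add: Sigma_hat_quadform)
    then show ?thesis
      by simp
  qed
  have "mv p (\<lambda>i j. Sigma_hat n X i j + lam * idm i j) (u i) j = (d i + lam) * u i j"
    if "i < p" "j < p" for i j
  proof -
    have "mv p (\<lambda>i j. Sigma_hat n X i j + lam * idm i j) (u i) j
        = mv p (Sigma_hat n X) (u i) j + lam * mv p idm (u i) j"
      by (simp add: mv_def algebra_simps sum.distrib sum_distrib_left)
    then show ?thesis
      using that by (simp add: e mv_idm algebra_simps)
  qed
  then have "eq_on p p (\<lambda>i j. Sigma_hat n X i j + lam * idm i j) (smat p u (\<lambda>k. d k + lam))"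
    by (intro eq_on_smat u)
  then have "ridge_res n p X lam = smat p u (\<lambda>k. 1 / (d k + lam))"
    unfolding ridge_res_def
    by (rule minv_smat[OF u]) (use d assms in \<open>auto simp: add_nonneg_eq_0_iff\<close>)
  moreover have "eq_on p p (Sigma_hat n X) (smat p u d)"
    by (intro eq_on_smat u e)
  ultimately show ?thesis
    using that u d e by blast
qed

lemma ridge_res_sym: "0 < lam \<Longrightarrow> ridge_res n p X lam i j = ridge_res n p X lam j i"
  by (metis ridge_spectral smat_sym)

text \<open>Resolvent identity R S = I - lam R with S the Gram matrix, read off eigenvalue by
  eigenvalue: d / (d + lam) = 1 - lam / (d + lam). The second term is the ridge bias.\<close>

lemma ridge_res_Sigma_hat:
  assumes "0 < lam" "j < p"
  shows "mv p (ridge_res n p X lam) (mv p (Sigma_hat n X) v) j = v j - lam * mv p (ridge_res n p X lam) v j"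
proof -
  obtain u d where u: "orthonormal p p u" "eq_on p p (Sigma_hat n X) (smat p u d)"
    "\<And>k. k < p \<Longrightarrow> 0 \<le> d k" "ridge_res n p X lam = smat p u (\<lambda>k. 1 / (d k + lam))"
    using ridge_spectral[OF assms(1), where n=n and p=p and X=X] by metis
  have "mv p (ridge_res n p X lam) (mv p (Sigma_hat n X) v) j = mv p (ridge_res n p X lam) (mv p (smat p u d) v) j"
    by (intro fun_cong[OF mv_cong] mv_eq_on u)
  also have "\<dots> = mv p (smat p u (\<lambda>k. 1 / (d k + lam) * d k)) v j"
    unfolding u(4) mv_mmul[symmetric] smat_mmul[OF u(1)] ..
  also have "\<dots> = (\<Sum>k<p. (1 - lam * (1 / (d k + lam))) * dot p (u k) v * u k j)"
  proof -
    have "1 / (d k + lam) * d k = 1 - lam * (1 / (d k + lam))" if "k < p" for k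
      using assms(1) u(3)[OF that] by (simp add: field_simps)
    then show ?thesis
      unfolding mv_smat[OF assms(2)] by (intro sum.cong) auto
  qed
  also have "\<dots> = mv p (smat p u (\<lambda>_. 1)) v j - lam * mv p (ridge_res n p X lam) v j"
    unfolding u(4) mv_smat[OF assms(2)]
    by (simp add: algebra_simps sum_subtractf sum_distrib_left)
  also have "mv p (smat p u (\<lambda>_. 1)) v j = v j"
    using mv_eq_on[OF smat_one[OF u(1)] assms(2)] mv_idm[OF assms(2)] by simp
  finally show ?thesis .
qed

text \<open>The Penrose equations give only G H G = G for G = X X^T and its pseudo-inverse H, and
  the trailing X^T has to be cancelled. This works because the squared row norms of W = (G H - I) X
  are the diagonal of W W^T.\<close>

lemma X_PX:
  assumes "i < n" "j < p"
  shows "mmul p X (PX n p X) i j = X i j"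
proof -
  define G where "G = mmul p X (mtr X)"
  define E where "E = (\<lambda>i j. mmul n G (pinv n n G) i j - idm i j)"
  define W where "W = mmul n E X"
  have "G i j = G j i" for i j
    by (simp add: G_def mmul_def mtr_def mult.commute)
  then have "penrose n n G (pinv n n G)"
    by (intro penrose_pinv_sym)
  then have GHG: "eq_on n n (mmul n (mmul n G (pinv n n G)) G) G"
    by (simp add: penrose_def)
  have W: "W i j = mmul p X (PX n p X) i j - X i j" if "i < n" for i j
  proof -
    have "mmul p X (PX n p X) = mmul n (mmul n G (pinv n n G)) X"
      by (simp add: PX_def G_def mmul_assoc)
    moreover have "(\<Sum>l<n. idm i l * X l j) = X i j"
      using that by (simp add: idm_def if_distrib if_distribR cong: if_cong)
    ultimately show ?thesis
      by (simp add: W_def E_def mmul_def[of n _ X] left_diff_distrib sum_subtractf)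
  qed
  have EG: "mmul n E G i m = 0" if "m < n" for m
  proof -
    have "(\<Sum>l<n. idm i l * G l m) = G i m"
      using assms by (simp add: idm_def if_distrib if_distribR cong: if_cong)
    then have "mmul n E G i m = mmul n (mmul n G (pinv n n G)) G i m - G i m"
      by (simp add: E_def mmul_def[of n _ G] left_diff_distrib sum_subtractf)
    then show ?thesis
      using GHG that assms by (simp add: eq_on_def)
  qed
  \<comment> \<open>\<open>W W\<^sup>T = E G E\<^sup>T = 0\<close>\<close>
  have "mmul p W (mtr W) = mmul n (mmul n E G) (mtr E)"
    by (simp add: W_def G_def mtr_mmul mmul_assoc)
  then have "mmul p W (mtr W) i i = 0"
    by (simp add: mmul_def[of n "mmul n E G"] EG)
  then have "dot p (W i) (W i) = 0"
    by (simp add: dot_def mmul_def mtr_def)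
  then show ?thesis
    using assms by (simp add: dot_eq_zero_iff W)
qed

lemma mv_X_PX: "i < n \<Longrightarrow> mv p X (mv p (PX n p X) v) i = mv p X v i"
  unfolding mv_mmul[symmetric] by (simp add: mv_def[of p _ v] X_PX)

lemma mv_mtr: "mv n (mtr X) v k = (\<Sum>i<n. X i k * v i)"
  by (simp add: mv_def mtr_def)

text \<open>Exhibits the projected vector as X^T w with an explicit w; this form is orthogonal to
  every null vector of X.\<close>

lemma mv_PX_row_space: "mv p (PX n p X) v k = (\<Sum>i<n. X i k * mv n (pinv n n (mmul p X (mtr X))) (mv p X v) i)"
  by (simp add: PX_def mv_mmul mv_mtr)

definition proj_noise :: "nat \<Rightarrow> nat \<Rightarrow> rmat \<Rightarrow> real \<Rightarrow> rmat" where
  "proj_noise n p X lam = (\<lambda>j i. (\<Sum>k<p. ridge_res n p X lam j k * X i k) / real n)"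

text \<open>The design sees \<beta> only through its projection \<theta>, as X \<beta> = X \<theta>.
  The signal part is therefore R applied to the Gram matrix times \<theta>, to which the resolvent
  identity applies.\<close>

lemma ridge_response:
  fixes n p :: nat and X :: rmat and \<beta> :: rvec
  assumes "0 < lam" "j < p"
  defines "\<theta> \<equiv> mv p (PX n p X) \<beta>"
  shows "ridge n p X lam (response n p X \<beta> \<epsilon>) j
    = \<theta> j - lam * mv p (ridge_res n p X lam) \<theta> j + (\<Sum>i<n. proj_noise n p X lam j i * \<epsilon> i)"
proof -
  let ?R = "ridge_res n p X lam"
  have "ridge n p X lam (response n p X \<beta> \<epsilon>) j
      = (\<Sum>k<p. ?R j k * ((\<Sum>i<n. X i k * mv p X \<beta> i) / real n)) + (\<Sum>k<p. \<Sum>i<n. ?R j k * X i k * \<epsilon> i / real n)"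
    by (simp add: ridge_def response_def mv_def algebra_simps sum.distrib sum_distrib_left sum_divide_distrib add_divide_distrib)
  also have "(\<Sum>k<p. \<Sum>i<n. ?R j k * X i k * \<epsilon> i / real n) = (\<Sum>i<n. \<Sum>k<p. ?R j k * X i k * \<epsilon> i / real n)"
    by (rule sum.swap)
  also have "\<dots> = (\<Sum>i<n. proj_noise n p X lam j i * \<epsilon> i)"
    by (simp add: proj_noise_def sum_distrib_right sum_divide_distrib)
  also have "(\<Sum>k<p. ?R j k * ((\<Sum>i<n. X i k * mv p X \<beta> i) / real n)) = mv p ?R (mv p (Sigma_hat n X) \<theta>) j"
    by (simp add: mv_def[of p ?R] mv_Sigma_hat \<theta>_def mv_X_PX)
  also have "\<dots> = \<theta> j - lam * mv p ?R \<theta> j"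
    using assms by (intro ridge_res_Sigma_hat)
  finally show ?thesis .
qed

text \<open>Symmetry of R turns R S R into n A A^T with A = R X^T / n. Consequently \<sigma>^2
  \<Omega> / n is \<sigma>^2 A A^T, the covariance of A applied to the noise.\<close>

lemma Omega_gram:
  assumes "1 \<le> n" "0 < lam"
  shows "Omega n p X lam i j = real n * (\<Sum>l<n. proj_noise n p X lam i l * proj_noise n p X lam j l)"
proof -
  let ?R = "ridge_res n p X lam"
  have "Omega n p X lam i j = (\<Sum>b<p. \<Sum>a<p. \<Sum>l<n. (?R i a * X l a) * (?R j b * X l b) / real n)"
    using ridge_res_sym[OF assms(2), of n p X _ j]
    by (simp add: Omega_def mmul_def Sigma_hat_def sum_distrib_left sum_distrib_right sum_divide_distrib mult_ac)
  also have "\<dots> = (\<Sum>l<n. \<Sum>b<p. \<Sum>a<p. (?R i a * X l a) * (?R j b * X l b) / real n)"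
    by (simp add: sum.swap[of _ "{..<n}"])
  also have "\<dots> = (\<Sum>l<n. (\<Sum>a<p. ?R i a * X l a) * (\<Sum>b<p. ?R j b * X l b) / real n)"
    by (simp only: sum_divide_distrib sum_product) (subst sum.swap, rule refl)
  also have "\<dots> = real n * (\<Sum>l<n. proj_noise n p X lam i l * proj_noise n p X lam j l)"
    using assms(1) by (simp add: proj_noise_def sum_distrib_left)
  finally show ?thesis .
qed

text \<open>An eigenvector has a nonzero component along some \<open>u i\<close>, and comparing
  these components identifies its eigenvalue with \<open>d i\<close>. This makes the set under
  \<open>Min\<close> in \<open>lambda_min_nz\<close> finite.\<close>

lemma eigenvalues_subset:
  assumes "orthonormal p p u" "eq_on p p A (smat p u d)"
  shows "{k. is_eigenvalue p A k} \<subseteq> d ` {..<p}"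
proof
  fix k assume "k \<in> {k. is_eigenvalue p A k}"
  then obtain v where v: "\<exists>i<p. v i \<noteq> 0" "\<And>i. i < p \<Longrightarrow> mv p A v i = k * v i"
    unfolding is_eigenvalue_def mv_def by auto
  then have "dot p v v \<noteq> 0"
    by (simp add: dot_eq_zero_iff)
  then obtain i where i: "i < p" "dot p (u i) v \<noteq> 0"
    unfolding parseval[OF assms(1), symmetric] by (metis (no_types, lifting) lessThan_iff power_zero_numeral sum.neutral)
  have "k * dot p (u i) v = dot p (u i) (mv p A v)"
    unfolding dot_scale_right[symmetric] by (rule dot_cong) (simp_all add: v)
  also have "\<dots> = dot p (u i) (\<lambda>m. \<Sum>l<p. d l * dot p (u l) v * u l m)"
    using mv_eq_on[OF assms(2)] by (intro dot_cong) (simp_all add: mv_smat)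
  also have "\<dots> = (\<Sum>l<p. if l = i then d i * dot p (u i) v else 0)"
    unfolding dot_linear using assms(1) i by (intro sum.cong) (auto simp: orthonormal_def)
  finally show "k \<in> d ` {..<p}"
    using i by simp
qed

text \<open>In the eigenbasis the bias multiplies each component of \<theta> by lam / (d + lam), at
  most lam / \<mu> where d is nonzero; components with d = 0 vanish. The absolute value on the right
  covers a zero Gram matrix: \<open>Min\<close> is then taken over the empty set and has unknown
  sign, while \<theta> = 0.\<close>

lemma ridge_bias_bound:
  fixes n p :: nat and X :: rmat and \<beta> :: rvec
  assumes "1 \<le> n" "0 < lam" "j < p"
  defines "\<theta> \<equiv> mv p (PX n p X) \<beta>"
  shows "\<bar>lam * mv p (ridge_res n p X lam) \<theta> j\<bar> \<le> \<bar>sqrt (dot p \<theta> \<theta>) * lam / lambda_min_nz p (Sigma_hat n X)\<bar>"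
proof -
  obtain u d where u: "orthonormal p p u" "eq_on p p (Sigma_hat n X) (smat p u d)"
    "\<And>k. k < p \<Longrightarrow> 0 \<le> d k" "ridge_res n p X lam = smat p u (\<lambda>k. 1 / (d k + lam))"
    and e: "\<And>k j. k < p \<Longrightarrow> j < p \<Longrightarrow> mv p (Sigma_hat n X) (u k) j = d k * u k j"
    using ridge_spectral[OF assms(2), where n=n and p=p and X=X] by metis
  define c where "c = (\<lambda>k. dot p (u k) \<theta>)"
  define g where "g = (\<lambda>k. lam / (d k + lam))"
  define \<mu> where "\<mu> = lambda_min_nz p (Sigma_hat n X)"
  \<comment> \<open>Eigenvalue zero means X u = 0, and \<theta> = X^T w, so <u, \<theta>> = <X u, w>
    = 0.\<close>
  have c0: "c k = 0" if "k < p" "d k = 0" for k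
  proof -
    have "dot p (u k) (mv p (Sigma_hat n X) (u k)) = dot p (u k) (\<lambda>_. 0)"
      by (rule dot_cong) (simp_all add: e that)
    then have "dot n (mv p X (u k)) (mv p X (u k)) = 0"
      using assms(1) by (simp add: Sigma_hat_quadform)
    then have Xu: "mv p X (u k) i = 0" if "i < n" for i
      using that by (simp add: dot_eq_zero_iff)
    define w where "w = mv n (pinv n n (mmul p X (mtr X))) (mv p X \<beta>)"
    have "c k = dot p (u k) (\<lambda>m. \<Sum>i<n. X i m * w i)"
      unfolding c_def \<theta>_def w_def by (rule dot_cong) (simp_all add: mv_PX_row_space)
    also have "\<dots> = (\<Sum>i<n. w i * mv p X (u k) i)"
      unfolding dot_linear by (simp add: dot_def mv_def sum_distrib_left mult_ac)
    finally show "c k = 0"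
      by (simp add: Xu)
  qed
  have bound: "(g k * c k)\<^sup>2 \<le> (lam / \<mu>)\<^sup>2 * (c k)\<^sup>2" if "k < p" for k
  proof (cases "d k = 0")
    case False
    let ?E = "{k. k \<noteq> 0 \<and> is_eigenvalue p (Sigma_hat n X) k}"
    have sub: "?E \<subseteq> d ` {..<p} - {0}"
      using eigenvalues_subset[OF u(1,2)] by auto
    then have fin: "finite ?E"
      by (rule finite_subset) simp
    \<comment> \<open>Being nonzero makes \<open>u k\<close> an admissible eigenvector, so
      \<open>?E\<close> contains \<open>d k\<close> and is nonempty; only then is \<mu> itself an
      eigenvalue, and hence positive.\<close>
    have "\<exists>i<p. u k i \<noteq> 0"
    proof (rule ccontr)
      assume "\<not> ?thesis"
      then have "dot p (u k) (u k) = 0" by (simp add: dot_eq_zero_iff)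
      then show False using u(1) that by (simp add: orthonormal_def)
    qed
    then have "d k \<in> ?E"
      using False e that by (auto simp: is_eigenvalue_def mv_def intro!: exI[of _ "u k"])
    then have "\<mu> \<le> d k" "\<mu> \<in> ?E"
      unfolding \<mu>_def lambda_min_nz_def using fin by (auto intro: Min_le) (metis (mono_tags, lifting) Min_in empty_iff mem_Collect_eq)+
    then have "0 < \<mu>" using sub u(3) by force
    then have "0 \<le> g k" "g k \<le> lam / \<mu>"
      unfolding g_def using \<open>\<mu> \<le> d k\<close> assms(2) by (auto intro!: divide_left_mono divide_nonneg_nonneg)
    then have "(g k)\<^sup>2 \<le> (lam / \<mu>)\<^sup>2"
      by (intro power_mono)
    then show ?thesis
      by (simp add: power_mult_distrib mult_right_mono del: power_divide)
  qed (simp add: c0 that)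
  have "lam * mv p (ridge_res n p X lam) \<theta> j = (\<Sum>k<p. (g k * c k) * u k j)"
    unfolding u(4) mv_smat[OF assms(3)] by (simp add: g_def c_def sum_distrib_left mult_ac)
  \<comment> \<open>Cauchy-Schwarz costs nothing in the dimension: by completeness the j-th
    coordinates of the eigenvectors have squares summing to 1, so the bound does not depend on
    j.\<close>
  then have "(lam * mv p (ridge_res n p X lam) \<theta> j)\<^sup>2 \<le> (\<Sum>k<p. (g k * c k)\<^sup>2) * (\<Sum>k<p. (u k j)\<^sup>2)"
    by (simp only:) (rule Cauchy_Schwarz_ineq_sum)
  also have "(\<Sum>k<p. (u k j)\<^sup>2) = 1"
    using orthonormal_complete[OF u(1) assms(3,3)] by (simp add: power2_eq_square)
  also have "(\<Sum>k<p. (g k * c k)\<^sup>2) \<le> (\<Sum>k<p. (lam / \<mu>)\<^sup>2 * (c k)\<^sup>2)"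
    by (intro sum_mono bound) simp
  also have "\<dots> = (lam / \<mu>)\<^sup>2 * dot p \<theta> \<theta>"
    by (simp add: c_def parseval[OF u(1)] flip: sum_distrib_left)
  also have "\<dots> = (sqrt (dot p \<theta> \<theta>) * lam / \<mu>)\<^sup>2"
    by (simp add: power_mult_distrib power_divide)
  finally have "(lam * mv p (ridge_res n p X lam) \<theta> j)\<^sup>2 \<le> (sqrt (dot p \<theta> \<theta>) * lam / \<mu>)\<^sup>2"
    by simp
  then show ?thesis
    unfolding \<mu>_def abs_le_square_iff .
qed

section \<open>Characteristic functions and joint laws\<close>

lemma norm_iexp [simp]: "norm (iexp x) = 1"
  by (simp add: norm_exp_i_times)

text \<open>\<open>D\<close> is the image under x of M reweighted by w / E w. The lower bound 1
  keeps the normalising constant positive, and the upper bound \<open>K\<close> gives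
  integrability.\<close>

lemma tilted_law:
  fixes x w :: "'a \<Rightarrow> real"
  assumes "prob_space M" and [measurable]: "x \<in> borel_measurable M" "w \<in> borel_measurable M"
    and w: "\<And>\<omega>. 1 \<le> w \<omega>" "\<And>\<omega>. w \<omega> \<le> K" and B: "B \<in> sets borel"
  obtains D where "real_distribution D" "0 < integral\<^sup>L M w"
    "\<forall>s. char D s = (CLINT \<omega>|M. w \<omega> * iexp (s * x \<omega>)) / integral\<^sup>L M w"
    "measure D B = (LINT \<omega>|M. w \<omega> * indicator B (x \<omega>)) / integral\<^sup>L M w"
proof -
  interpret prob_space M by fact
  have pos: "0 \<le> w \<omega>" for \<omega> using w(1)[of \<omega>] by simp
  have int: "integrable M w"
    using pos w(2) by (intro integrable_const_bound[of _ K]) auto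
  define c where "c = integral\<^sup>L M w"
  have "(LINT \<omega>|M. 1) \<le> c"
    unfolding c_def using int w(1) by (intro integral_mono) auto
  then have c: "0 < c" by (simp add: prob_space)
  define D where "D = density M (\<lambda>\<omega>. ennreal (w \<omega> / c))"
  have "emeasure D (space D) = (\<integral>\<^sup>+ \<omega>. ennreal (w \<omega> / c) \<partial>M)"
    by (auto simp: D_def emeasure_density intro!: nn_integral_cong)
  also have "\<dots> = ennreal (LINT \<omega>|M. w \<omega> / c)"
    using int c pos by (intro nn_integral_eq_integral) auto
  also have "\<dots> = 1"
    using c by (simp add: c_def)
  finally interpret D: prob_space D
    by (rule prob_spaceI)
  have [measurable]: "x \<in> borel_measurable D" by (simp add: D_def)
  have "real_distribution (distr D borel x)"
    by (rule D.real_distribution_distr) simp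
  moreover have "char (distr D borel x) s = (CLINT \<omega>|M. w \<omega> * iexp (s * x \<omega>)) / c" for s
  proof -
    have "char (distr D borel x) s = (CLINT \<omega>|D. iexp (s * x \<omega>))"
      by (simp add: char_def integral_distr)
    also have "\<dots> = (CLINT \<omega>|M. (w \<omega> / c) *\<^sub>R iexp (s * x \<omega>))"
      unfolding D_def using pos c by (subst integral_density) auto
    also have "\<dots> = (CLINT \<omega>|M. w \<omega> * iexp (s * x \<omega>) / c)"
      by (simp add: scaleR_conv_of_real)
    finally show ?thesis by simp
  qed
  moreover have "measure (distr D borel x) B = (LINT \<omega>|M. w \<omega> * indicator B (x \<omega>)) / c"
  proof -
    have "measure (distr D borel x) B = (LINT z|distr D borel x. indicator B z)"
      using B by simp
    also have "\<dots> = (LINT \<omega>|D. indicator B (x \<omega>))"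
      using B by (subst integral_distr) auto
    also have "\<dots> = (LINT \<omega>|M. (w \<omega> / c) *\<^sub>R indicator B (x \<omega>))"
      unfolding D_def using pos c B by (subst integral_density) auto
    also have "\<dots> = (LINT \<omega>|M. w \<omega> * indicator B (x \<omega>) / c)"
      by simp
    finally show ?thesis by simp
  qed
  ultimately show ?thesis
    using that[of "distr D borel x"] c unfolding c_def by blast
qed

text \<open>Levy uniqueness for the two tilted laws. The case s = 0 of the hypothesis shows that
  their normalising constants agree, so the normalisation can be undone.\<close>

lemma weighted_char_uniqueness:
  fixes x w :: "'a \<Rightarrow> real" and y v :: "'b \<Rightarrow> real"
  assumes M: "prob_space M" and N: "prob_space N"
    and [measurable]: "x \<in> borel_measurable M" "y \<in> borel_measurable N"
      "w \<in> borel_measurable M" "v \<in> borel_measurable N"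
    and w: "\<And>\<omega>. 1 \<le> w \<omega>" "\<And>\<omega>. w \<omega> \<le> K" and v: "\<And>\<omega>. 1 \<le> v \<omega>" "\<And>\<omega>. v \<omega> \<le> K"
    and eq: "\<And>s. (CLINT \<omega>|M. w \<omega> * iexp (s * x \<omega>)) = (CLINT \<omega>|N. v \<omega> * iexp (s * y \<omega>))"
    and B: "B \<in> sets borel"
  shows "(LINT \<omega>|M. w \<omega> * indicator B (x \<omega>)) = (LINT \<omega>|N. v \<omega> * indicator B (y \<omega>))"
proof -
  obtain D where D: "real_distribution D" "0 < integral\<^sup>L M w"
    "\<forall>s. char D s = (CLINT \<omega>|M. w \<omega> * iexp (s * x \<omega>)) / integral\<^sup>L M w"
    "measure D B = (LINT \<omega>|M. w \<omega> * indicator B (x \<omega>)) / integral\<^sup>L M w"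
    by (rule tilted_law[OF M assms(3,5) w B]) (rule that)
  obtain E where E: "real_distribution E" "0 < integral\<^sup>L N v"
    "\<forall>s. char E s = (CLINT \<omega>|N. v \<omega> * iexp (s * y \<omega>)) / integral\<^sup>L N v"
    "measure E B = (LINT \<omega>|N. v \<omega> * indicator B (y \<omega>)) / integral\<^sup>L N v"
    by (rule tilted_law[OF N assms(4,6) v B]) (rule that)
  have "complex_of_real (integral\<^sup>L M w) = of_real (integral\<^sup>L N v)"
    using eq[of 0] by simp
  then have c: "integral\<^sup>L M w = integral\<^sup>L N v"
    by (simp only: of_real_eq_iff)
  have "char D = char E"
    by (rule ext) (simp only: D(3)[rule_format] E(3)[rule_format] eq c)
  then have "D = E"
    using D(1) E(1) by (intro Levy_uniqueness)
  then show ?thesis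
    using D(2,4) E(4) c by simp
qed

text \<open>Extends uniqueness to bounded complex weights by treating real and imaginary part
  separately. Complex weights are what the coordinatewise argument for joint laws produces.\<close>

lemma complex_weighted_char_uniqueness:
  fixes x :: "'a \<Rightarrow> real" and y :: "'b \<Rightarrow> real"
  assumes M: "prob_space M" and N: "prob_space N"
    and [measurable]: "x \<in> borel_measurable M" "y \<in> borel_measurable N"
      "f \<in> borel_measurable M" "g \<in> borel_measurable N"
    and f: "\<And>\<omega>. cmod (f \<omega>) \<le> 1" and g: "\<And>\<omega>. cmod (g \<omega>) \<le> 1"
    and eq1: "\<And>s. (CLINT \<omega>|M. iexp (s * x \<omega>)) = (CLINT \<omega>|N. iexp (s * y \<omega>))"
    and eq: "\<And>s. (CLINT \<omega>|M. f \<omega> * iexp (s * x \<omega>)) = (CLINT \<omega>|N. g \<omega> * iexp (s * y \<omega>))"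
    and B[measurable]: "B \<in> sets borel"
  shows "(CLINT \<omega>|M. f \<omega> * indicator B (x \<omega>)) = (CLINT \<omega>|N. g \<omega> * indicator B (y \<omega>))"
proof -
  interpret M: prob_space M by fact
  interpret N: prob_space N by fact
  \<comment> \<open>Adding the constant 2 makes the weight positive without losing information, as the unweighted characteristic functions agree.\<close>
  have real: "(LINT \<omega>|M. w \<omega> * indicator B (x \<omega>)) = (LINT \<omega>|N. v \<omega> * indicator B (y \<omega>))"
    if [measurable]: "w \<in> borel_measurable M" "v \<in> borel_measurable N"
      and w: "\<And>\<omega>. \<bar>w \<omega>\<bar> \<le> 1" and v: "\<And>\<omega>. \<bar>v \<omega>\<bar> \<le> 1"
      and eq: "\<And>s. (CLINT \<omega>|M. w \<omega> * iexp (s * x \<omega>)) = (CLINT \<omega>|N. v \<omega> * iexp (s * y \<omega>))"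
    for w :: "'a \<Rightarrow> real" and v :: "'b \<Rightarrow> real"
  proof -
    have 1: "(LINT \<omega>|M. 1 * indicator B (x \<omega>) :: real) = (LINT \<omega>|N. 1 * indicator B (y \<omega>))"
      by (rule weighted_char_uniqueness[OF M N, where K=1 and w="\<lambda>_. 1" and v="\<lambda>_. 1"]) (use eq1 in auto)
    have iM: "integrable M (\<lambda>\<omega>. w \<omega> * iexp (s * x \<omega>))" "integrable M (\<lambda>\<omega>. iexp (s * x \<omega>))"
        "integrable M (\<lambda>\<omega>. w \<omega> * indicator B (x \<omega>))" "integrable M (\<lambda>\<omega>. indicator B (x \<omega>) :: real)" for s
      using w by (auto intro!: M.integrable_const_bound[of _ 1] simp: norm_mult indicator_def)
    have iN: "integrable N (\<lambda>\<omega>. v \<omega> * iexp (s * y \<omega>))" "integrable N (\<lambda>\<omega>. iexp (s * y \<omega>))"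
        "integrable N (\<lambda>\<omega>. v \<omega> * indicator B (y \<omega>))" "integrable N (\<lambda>\<omega>. indicator B (y \<omega>) :: real)" for s
      using v by (auto intro!: N.integrable_const_bound[of _ 1] simp: norm_mult indicator_def)
    have "(LINT \<omega>|M. (2 + w \<omega>) * indicator B (x \<omega>)) = (LINT \<omega>|N. (2 + v \<omega>) * indicator B (y \<omega>))"
    proof (rule weighted_char_uniqueness[OF M N, where K=3 and w="\<lambda>\<omega>. 2 + w \<omega>" and v="\<lambda>\<omega>. 2 + v \<omega>"])
      show "1 \<le> 2 + w \<omega>" "2 + w \<omega> \<le> 3" for \<omega> using w[of \<omega>] by auto
      show "1 \<le> 2 + v \<omega>" "2 + v \<omega> \<le> 3" for \<omega> using v[of \<omega>] by auto
      show "(CLINT \<omega>|M. (2 + w \<omega>) * iexp (s * x \<omega>)) = (CLINT \<omega>|N. (2 + v \<omega>) * iexp (s * y \<omega>))" for s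
        using iM iN eq[of s] eq1[of s] by (simp add: distrib_right)
    qed auto
    with 1 show ?thesis
      using iM(3,4) iN(3,4) by (simp add: distrib_right)
  qed
  have iM: "integrable M (\<lambda>\<omega>. f \<omega> * iexp (s * x \<omega>))" "integrable M (\<lambda>\<omega>. f \<omega> * indicator B (x \<omega>))" for s
    using f by (auto intro!: M.integrable_const_bound[of _ 1] simp: norm_mult indicator_def)
  have iN: "integrable N (\<lambda>\<omega>. g \<omega> * iexp (s * y \<omega>))" "integrable N (\<lambda>\<omega>. g \<omega> * indicator B (y \<omega>))" for s
    using g by (auto intro!: N.integrable_const_bound[of _ 1] simp: norm_mult indicator_def)
  \<comment> \<open>The transform of the real part of a weight combines the transform of the weight
    at s with the conjugate of the one at -s; this uses the hypothesis at both arguments.\<close>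
  have Re: "complex_of_real (Re z) * iexp t = (z * iexp t + cnj (z * iexp (- t))) / 2"
    and Im: "complex_of_real (Im z) * iexp t = (z * iexp t - cnj (z * iexp (- t))) / (2 * \<i>)" for z t
  proof -
    have h: "cnj (z * iexp (- t)) = cnj z * iexp t"
      by (simp add: exp_cnj)
    show "complex_of_real (Re z) * iexp t = (z * iexp t + cnj (z * iexp (- t))) / 2"
      "complex_of_real (Im z) * iexp t = (z * iexp t - cnj (z * iexp (- t))) / (2 * \<i>)"
      by (simp_all only: h distrib_right[symmetric] left_diff_distrib[symmetric] complex_add_cnj complex_diff_cnj) (simp_all add: field_simps)
  qed
  have cnj_eq: "(CLINT \<omega>|M. cnj (f \<omega> * iexp (- (s * x \<omega>)))) = (CLINT \<omega>|N. cnj (g \<omega> * iexp (- (s * y \<omega>))))" for s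
    using eq[of "- s"] by (simp only: Bochner_Integration.integral_cnj mult_minus_left)
  have ciM: "integrable M (\<lambda>\<omega>. cnj (f \<omega> * iexp (- (s * x \<omega>))))" for s
    using iM(1)[of "- s"] by (intro integrable_cnj) simp
  have ciN: "integrable N (\<lambda>\<omega>. cnj (g \<omega> * iexp (- (s * y \<omega>))))" for s
    using iN(1)[of "- s"] by (intro integrable_cnj) simp
  have "(LINT \<omega>|M. Re (f \<omega>) * indicator B (x \<omega>)) = (LINT \<omega>|N. Re (g \<omega>) * indicator B (y \<omega>))"
  proof (rule real)
    show "(CLINT \<omega>|M. Re (f \<omega>) * iexp (s * x \<omega>)) = (CLINT \<omega>|N. Re (g \<omega>) * iexp (s * y \<omega>))" for s
      unfolding Re integral_divide_zero
      by (simp only: Bochner_Integration.integral_add[OF iM(1) ciM] Bochner_Integration.integral_add[OF iN(1) ciN] eq cnj_eq)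
  qed (use f g in \<open>auto intro: order_trans[OF abs_Re_le_cmod]\<close>)
  moreover have "(LINT \<omega>|M. Im (f \<omega>) * indicator B (x \<omega>)) = (LINT \<omega>|N. Im (g \<omega>) * indicator B (y \<omega>))"
  proof (rule real)
    show "(CLINT \<omega>|M. Im (f \<omega>) * iexp (s * x \<omega>)) = (CLINT \<omega>|N. Im (g \<omega>) * iexp (s * y \<omega>))" for s
      unfolding Im integral_divide_zero
      by (simp only: Bochner_Integration.integral_diff[OF iM(1) ciM] Bochner_Integration.integral_diff[OF iN(1) ciN] eq cnj_eq)
  qed (use f g in \<open>auto intro: order_trans[OF abs_Im_le_cmod]\<close>)
  moreover have "Re (z * indicator B r) = Re z * indicator B r" "Im (z * indicator B r) = Im z * indicator B r"
    for z and r :: real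
    by (auto simp: indicator_def)
  ultimately show ?thesis
    using iM(2) iN(2) by (simp add: complex_eq_iff flip: integral_Re integral_Im)
qed

lemma complex_integral_indicator:
  assumes "S \<in> sets M"
  shows "(CLINT \<omega>|M. indicator S \<omega>) = of_real (measure M S)"
proof -
  have "(\<lambda>\<omega>. indicator S \<omega> :: complex) = (\<lambda>\<omega>. of_real (indicator S \<omega>))"
    by (auto simp: indicator_def)
  then show ?thesis
    using assms by (simp add: sets.Int_space_eq2)
qed

text \<open>One-dimensional uniqueness is applied one coordinate at a time: each pass inserts an
  indicator of a set in one more coordinate, the indicators gained so far and the exponential acting
  as the weight. After p passes with t = 0 the laws agree on boxes.\<close>

lemma joint_law_eqI_char:
  fixes x :: "nat \<Rightarrow> 'a \<Rightarrow> real" and y :: "nat \<Rightarrow> 'b \<Rightarrow> real"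
  assumes M: "prob_space M" and N: "prob_space N"
    and x[measurable]: "\<And>j. x j \<in> borel_measurable M" and y[measurable]: "\<And>j. y j \<in> borel_measurable N"
    and eq: "\<And>t. (CLINT \<omega>|M. iexp (\<Sum>j<p. t j * x j \<omega>)) = (CLINT \<omega>|N. iexp (\<Sum>j<p. t j * y j \<omega>))"
  shows "distr M (PiM {..<p} (\<lambda>_. borel)) (\<lambda>\<omega>. \<lambda>j\<in>{..<p}. x j \<omega>)
    = distr N (PiM {..<p} (\<lambda>_. borel)) (\<lambda>\<omega>. \<lambda>j\<in>{..<p}. y j \<omega>)" (is "distr M ?P ?x = distr N ?P ?y")
proof -
  interpret M: prob_space M by fact
  interpret N: prob_space N by fact
  have step: "(CLINT \<omega>|M. (\<Prod>j<m. indicator (B j) (x j \<omega>)) * iexp (\<Sum>j<p. t j * x j \<omega>))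
      = (CLINT \<omega>|N. (\<Prod>j<m. indicator (B j) (y j \<omega>)) * iexp (\<Sum>j<p. t j * y j \<omega>))"
    if "m \<le> p" "\<And>j. B j \<in> sets borel" for m t and B :: "nat \<Rightarrow> real set"
    using that(1)
  proof (induction m arbitrary: t)
    case 0
    show ?case using eq[of t] by simp
  next
    case (Suc m)
    note [measurable] = that(2)
    \<comment> \<open>Raising \<open>t m\<close> by s adds s times the m-th coordinate to the
      exponent, so the induction hypothesis for varying t is exactly the transform in that
      coordinate; hence t is arbitrary in the induction.\<close>
    have upd: "(\<Sum>j<p. (t(m := t m + s)) j * z j) = (\<Sum>j<p. t j * z j) + s * z m" for s and t z :: "nat \<Rightarrow> real"
      using Suc.prems by (simp add: sum.remove[of "{..<p}" m] algebra_simps)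
    have bnd: "norm ((\<Prod>j<m. indicator (B j) (z j) :: complex) * iexp r) \<le> 1" for z :: "nat \<Rightarrow> real" and r
      by (simp add: norm_mult prod_norm[symmetric] prod_le_1 indicator_def)
    have "(CLINT \<omega>|M. ((\<Prod>j<m. indicator (B j) (x j \<omega>)) * iexp (\<Sum>j<p. t j * x j \<omega>)) * indicator (B m) (x m \<omega>))
      = (CLINT \<omega>|N. ((\<Prod>j<m. indicator (B j) (y j \<omega>)) * iexp (\<Sum>j<p. t j * y j \<omega>)) * indicator (B m) (y m \<omega>))"
    proof (rule complex_weighted_char_uniqueness[OF M N])
      show "(CLINT \<omega>|M. iexp (s * x m \<omega>)) = (CLINT \<omega>|N. iexp (s * y m \<omega>))" for s
        using eq[of "(\<lambda>_. 0)(m := 0 + s)"] unfolding upd[of "\<lambda>_. 0" s] by simp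
      show "(CLINT \<omega>|M. (\<Prod>j<m. indicator (B j) (x j \<omega>)) * iexp (\<Sum>j<p. t j * x j \<omega>) * iexp (s * x m \<omega>))
        = (CLINT \<omega>|N. (\<Prod>j<m. indicator (B j) (y j \<omega>)) * iexp (\<Sum>j<p. t j * y j \<omega>) * iexp (s * y m \<omega>))" for s
        using Suc.IH[of "t(m := t m + s)"] Suc.prems unfolding upd[of t s]
        by (simp add: distrib_left exp_add mult.assoc)
      show "cmod ((\<Prod>j<m. indicator (B j) (x j \<omega>)) * iexp (\<Sum>j<p. t j * x j \<omega>)) \<le> 1" for \<omega>
        by (rule bnd)
      show "cmod ((\<Prod>j<m. indicator (B j) (y j \<omega>)) * iexp (\<Sum>j<p. t j * y j \<omega>)) \<le> 1" for \<omega>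
        by (rule bnd)
    qed auto
    then show ?case
      by (simp only: prod.lessThan_Suc mult.assoc mult.commute[of "indicator (B m) _"])
  qed
  have box: "emeasure (distr M ?P ?x) (PiE {..<p} B) = emeasure (distr N ?P ?y) (PiE {..<p} B)"
    if "\<And>i. i \<in> {..<p} \<Longrightarrow> B i \<in> sets borel" for B
  proof -
    \<comment> \<open>The box has measurable sides only below p, whereas \<open>step\<close> asks
      for them at every index; the empty set fills the rest.\<close>
    define B' where "B' = (\<lambda>j. if j < p then B j else {})"
    have B'[measurable]: "B' j \<in> sets borel" for j using that by (auto simp: B'_def)
    have pr: "(\<Prod>j<p. indicator (B' j) (z j) :: complex) = indicator {z. \<forall>j<p. z j \<in> B' j} z" for z :: "nat \<Rightarrow> real"
      by (auto simp: indicator_def)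
    have "complex_of_real (measure M {\<omega> \<in> space M. \<forall>j<p. x j \<omega> \<in> B' j}) = of_real (measure N {\<omega> \<in> space N. \<forall>j<p. y j \<omega> \<in> B' j})"
    proof -
      have "complex_of_real (measure M {\<omega> \<in> space M. \<forall>j<p. x j \<omega> \<in> B' j})
          = (CLINT \<omega>|M. indicator {\<omega> \<in> space M. \<forall>j<p. x j \<omega> \<in> B' j} \<omega>)"
        by (rule complex_integral_indicator[symmetric]) measurable
      also have "\<dots> = (CLINT \<omega>|M. (\<Prod>j<p. indicator (B' j) (x j \<omega>)) * iexp (\<Sum>j<p. 0 * x j \<omega>))"
        unfolding pr by (intro Bochner_Integration.integral_cong) (auto simp: indicator_def)
      also have "\<dots> = (CLINT \<omega>|N. (\<Prod>j<p. indicator (B' j) (y j \<omega>)) * iexp (\<Sum>j<p. 0 * y j \<omega>))"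
        by (rule step) auto
      also have "\<dots> = (CLINT \<omega>|N. indicator {\<omega> \<in> space N. \<forall>j<p. y j \<omega> \<in> B' j} \<omega>)"
        unfolding pr by (intro Bochner_Integration.integral_cong) (auto simp: indicator_def)
      also have "\<dots> = of_real (measure N {\<omega> \<in> space N. \<forall>j<p. y j \<omega> \<in> B' j})"
        by (rule complex_integral_indicator) measurable
      finally show ?thesis .
    qed
    then have "emeasure M {\<omega> \<in> space M. \<forall>j<p. x j \<omega> \<in> B' j} = emeasure N {\<omega> \<in> space N. \<forall>j<p. y j \<omega> \<in> B' j}"
      by (simp add: M.emeasure_eq_measure N.emeasure_eq_measure)
    moreover have "?x -` PiE {..<p} B \<inter> space M = {\<omega> \<in> space M. \<forall>j<p. x j \<omega> \<in> B' j}"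
      "?y -` PiE {..<p} B \<inter> space N = {\<omega> \<in> space N. \<forall>j<p. y j \<omega> \<in> B' j}"
      by (auto simp: B'_def PiE_def Pi_def)
    ultimately show ?thesis
      using that by (simp add: emeasure_distr sets_PiM_I_finite)
  qed
  show ?thesis
  proof (rule measure_eqI_PiM_finite[where I="{..<p}" and M="\<lambda>_. borel" and A="\<lambda>_. space ?P"])
    interpret D: prob_space "distr M ?P ?x"
      by (rule M.prob_space_distr) simp
    show "emeasure (distr M ?P ?x) (space ?P) \<noteq> \<infinity>"
      using D.emeasure_finite by simp
    show "range (\<lambda>_. space ?P) \<subseteq> prod_algebra {..<p} (\<lambda>_. borel)"
      using prod_algebraI_finite[of "{..<p}" "\<lambda>_. UNIV" "\<lambda>_. borel"] by (auto simp: space_PiM)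
    show "emeasure (distr M ?P ?x) (PiE {..<p} B) = emeasure (distr N ?P ?y) (PiE {..<p} B)"
      if "\<And>i. i \<in> {..<p} \<Longrightarrow> B i \<in> sets borel" for B
      using that by (rule box)
  qed auto
qed

section \<open>Linear images of Gaussian noise\<close>

lemma char_normal:
  assumes "0 < \<sigma>"
  shows "(CLINT x|density lborel (normal_density 0 \<sigma>). iexp (b * x)) = exp (- (\<sigma>\<^sup>2 * b\<^sup>2) / 2)"
proof -
  interpret prob_space std_normal_distribution
    by (rule prob_space_normal_density) simp
  have "distributed std_normal_distribution lborel (\<lambda>x. x) std_normal_density"
    by (auto simp: distributed_def distr_id2)
  from normal_density_affine[OF this, of \<sigma> 0]
  have "density lborel (normal_density 0 \<sigma>) = distr std_normal_distribution lborel (\<lambda>x. \<sigma> * x)"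
    using assms by (simp add: distributed_distr_eq_density)
  then have "(CLINT x|density lborel (normal_density 0 \<sigma>). iexp (b * x)) = (CLINT x|std_normal_distribution. iexp ((b * \<sigma>) * x))"
    by (simp add: integral_distr mult.assoc)
  also have "\<dots> = char std_normal_distribution (b * \<sigma>)"
    by (simp add: char_def)
  finally show ?thesis
    by (simp add: char_std_normal_distribution power_mult_distrib mult.commute)
qed

lemma prob_space_noise_law: "0 < \<sigma> \<Longrightarrow> prob_space (noise_law n \<sigma>)"
  unfolding noise_law_def by (intro prob_space_PiM prob_space_normal_density)

lemma noise_law_coordinate_measurable: "i < n \<Longrightarrow> (\<lambda>\<epsilon>. \<epsilon> i) \<in> borel_measurable (noise_law n \<sigma>)"
  unfolding noise_law_def by measurable

lemma linear_noise_measurable [measurable]: "(\<lambda>\<epsilon>. \<Sum>i<n. a i * \<epsilon> i) \<in> borel_measurable (noise_law n \<sigma>)"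
  by (intro borel_measurable_sum borel_measurable_times noise_law_coordinate_measurable) auto

text \<open>Exchanging the sums makes the exponent a combination of independent coordinates, and the
  expectation factorises. The result involves A only through A A^T, which allows comparing noises of
  different dimension.\<close>

lemma char_linear_noise:
  assumes "0 < \<sigma>"
  shows "(CLINT \<epsilon>|noise_law n \<sigma>. iexp (\<Sum>j<p. t j * (\<Sum>i<n. A j i * \<epsilon> i)))
    = exp (- (\<sigma>\<^sup>2 * (\<Sum>j<p. \<Sum>k<p. t j * t k * (\<Sum>i<n. A j i * A k i))) / 2)"
proof -
  interpret product_prob_space "\<lambda>_::nat. density lborel (normal_density 0 \<sigma>)" "{..<n}"
    by (intro product_prob_spaceI prob_space_normal_density assms)
  define b where "b = (\<lambda>i. \<Sum>j<p. t j * A j i)"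
  have "(\<Sum>j<p. t j * (\<Sum>i<n. A j i * \<epsilon> i)) = (\<Sum>i<n. b i * \<epsilon> i)" for \<epsilon> :: rvec
    unfolding b_def sum_distrib_left sum_distrib_right by (subst sum.swap) (simp add: mult.assoc)
  then have "(CLINT \<epsilon>|noise_law n \<sigma>. iexp (\<Sum>j<p. t j * (\<Sum>i<n. A j i * \<epsilon> i)))
      = (CLINT \<epsilon>|noise_law n \<sigma>. (\<Prod>i<n. iexp (b i * \<epsilon> i)))"
    by (simp add: sum_distrib_left exp_sum)
  also have "\<dots> = (\<Prod>i<n. CLINT x|density lborel (normal_density 0 \<sigma>). iexp (b i * x))"
    unfolding noise_law_def
  proof (rule product_integral_prod)
    show "integrable (density lborel (normal_density 0 \<sigma>)) (\<lambda>x. iexp (b i * x))" for i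
      by (rule finite_measure.integrable_const_bound[OF prob_space.finite_measure[OF prob_space_normal_density[OF assms]], of _ 1]) auto
  qed simp
  also have "\<dots> = complex_of_real (exp (\<Sum>i<n. - (\<sigma>\<^sup>2 * (b i)\<^sup>2) / 2))"
    by (simp only: char_normal[OF assms] exp_sum[OF finite_lessThan] of_real_prod)
  also have "(\<Sum>i<n. - (\<sigma>\<^sup>2 * (b i)\<^sup>2) / 2) = - (\<sigma>\<^sup>2 * (\<Sum>i<n. (b i)\<^sup>2)) / 2"
    by (simp add: sum_negf sum_divide_distrib sum_distrib_left)
  also have "(\<Sum>i<n. (b i)\<^sup>2) = (\<Sum>i<n. \<Sum>j<p. \<Sum>k<p. t j * t k * (A j i * A k i))"
    by (simp add: b_def power2_eq_square sum_product mult_ac)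
  also have "\<dots> = (\<Sum>j<p. \<Sum>k<p. t j * t k * (\<Sum>i<n. A j i * A k i))"
    by (simp add: sum.swap[of _ _ "{..<n}"] sum_distrib_left)
  finally show ?thesis .
qed

section \<open>False positives\<close>

text \<open>By definition \<open>gauss_law\<close> is the image of \<open>noise_law p 1\<close>
  under the root of C, so both sides are linear noise with the same scaled Gram matrix. No
  invertibility of C enters.\<close>

lemma gauss_law_eq_linear_noise:
  assumes "0 < \<sigma>" and C: "\<And>j k. j < p \<Longrightarrow> k < p \<Longrightarrow> C j k = \<sigma>\<^sup>2 * (\<Sum>i<n. A j i * A k i)"
  shows "gauss_law p C = distr (noise_law n \<sigma>) (PiM {..<p} (\<lambda>_. borel)) (\<lambda>\<epsilon>. \<lambda>j\<in>{..<p}. \<Sum>i<n. A j i * \<epsilon> i)"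
proof -
  have gram: "(\<Sum>i<p. msqrt p C j i * msqrt p C k i) = \<sigma>\<^sup>2 * (\<Sum>i<n. A j i * A k i)" if "j < p" "k < p" for j k
  proof -
    have "C j k = (\<Sum>i<n. (\<sigma> * A j i) * (\<sigma> * A k i))" if "j < p" "k < p" for j k
      using that by (simp add: C sum_distrib_left power2_eq_square mult_ac)
    from msqrt_gram[OF this that] show ?thesis
      using that by (simp add: C)
  qed
  have "gauss_law p C = distr (noise_law p 1) (PiM {..<p} (\<lambda>_. borel)) (\<lambda>g. \<lambda>j\<in>{..<p}. \<Sum>k<p. msqrt p C j k * g k)"
    by (simp add: gauss_law_def noise_law_def std_normal_def)
  also have "\<dots> = distr (noise_law n \<sigma>) (PiM {..<p} (\<lambda>_. borel)) (\<lambda>\<epsilon>. \<lambda>j\<in>{..<p}. \<Sum>i<n. A j i * \<epsilon> i)"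
  proof (rule joint_law_eqI_char)
    fix t :: rvec
    have "1\<^sup>2 * (\<Sum>j<p. \<Sum>k<p. t j * t k * (\<Sum>i<p. msqrt p C j i * msqrt p C k i))
        = \<sigma>\<^sup>2 * (\<Sum>j<p. \<Sum>k<p. t j * t k * (\<Sum>i<n. A j i * A k i))"
      by (simp add: gram sum_distrib_left mult.left_commute)
    then show "(CLINT g|noise_law p 1. iexp (\<Sum>j<p. t j * (\<Sum>k<p. msqrt p C j k * g k)))
        = (CLINT \<epsilon>|noise_law n \<sigma>. iexp (\<Sum>j<p. t j * (\<Sum>i<n. A j i * \<epsilon> i)))"
      by (simp only: char_linear_noise[OF assms(1)] char_linear_noise[OF zero_less_one])
  qed (use assms(1) in \<open>auto intro: prob_space_noise_law\<close>)
  finally show ?thesis .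
qed

text \<open>F may have jumps or flat pieces, and the half-line on which F is at most \<alpha> may be
  open or closed. Inner regularity treats these alike: a nonempty compact subset has a largest point
  s, so its mass is at most F s, hence at most \<alpha>.\<close>

lemma (in prob_space) cdf_transform_superuniform:
  fixes Y :: "'a \<Rightarrow> real"
  assumes Y[measurable]: "Y \<in> borel_measurable M" and "0 \<le> \<alpha>"
  defines "F \<equiv> \<lambda>c. prob {\<omega> \<in> space M. Y \<omega> \<le> c}"
  shows "prob {\<omega> \<in> space M. F (Y \<omega>) \<le> \<alpha>} \<le> \<alpha>" "F \<in> borel_measurable borel" "mono F"
proof -
  show "mono F"
  proof (intro monoI)
    fix c d :: real assume "c \<le> d"
    moreover have "{\<omega> \<in> space M. Y \<omega> \<le> d} \<in> events"
      by measurable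
    ultimately show "F c \<le> F d"
      unfolding F_def by (intro finite_measure_mono) auto
  qed
  then show F[measurable]: "F \<in> borel_measurable borel"
    by (rule borel_measurable_mono)
  let ?D = "distr M borel Y" and ?A = "{c. F c \<le> \<alpha>}"
  interpret D: prob_space ?D
    by (rule prob_space_distr) simp
  have A: "?A \<in> sets borel"
    by measurable
  have "emeasure ?D ?A = (SUP K \<in> {K. K \<subseteq> ?A \<and> compact K}. emeasure ?D K)"
    using A by (intro inner_regular) auto
  also have "\<dots> \<le> ennreal \<alpha>"
  proof (rule SUP_least)
    fix K assume K: "K \<in> {K. K \<subseteq> ?A \<and> compact K}"
    show "emeasure ?D K \<le> ennreal \<alpha>"
    proof (cases "K = {}")
      case False
      then obtain s where s: "s \<in> K" "\<And>t. t \<in> K \<Longrightarrow> t \<le> s"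
        using K compact_attains_sup[of K] by auto
      have "emeasure ?D K \<le> emeasure ?D {..s}"
        using s by (intro emeasure_mono) auto
      also have "\<dots> = emeasure M {\<omega> \<in> space M. Y \<omega> \<le> s}"
        by (subst emeasure_distr) (auto intro!: arg_cong[where f="emeasure M"])
      also have "\<dots> = ennreal (F s)"
        by (simp add: F_def emeasure_eq_measure)
      also have "\<dots> \<le> ennreal \<alpha>"
        using s K by (intro ennreal_leI) auto
      finally show ?thesis .
    qed simp
  qed
  finally have "emeasure ?D ?A \<le> ennreal \<alpha>" .
  moreover have "emeasure ?D ?A = emeasure M {\<omega> \<in> space M. F (Y \<omega>) \<le> \<alpha>}"
    using A by (subst emeasure_distr) (auto intro!: arg_cong[where f="emeasure M"])
  ultimately show "prob {\<omega> \<in> space M. F (Y \<omega>) \<le> \<alpha>} \<le> \<alpha>"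
    using assms(2) by (simp add: emeasure_eq_measure)
qed

section \<open>The standard normal distribution function\<close>

lemma prob_space_std_normal: "prob_space std_normal"
  unfolding std_normal_def by (rule prob_space_normal_density) simp

lemma sets_std_normal [simp, measurable_cong]: "sets std_normal = sets borel"
  by (simp add: std_normal_def)

lemma mono_Phi: "mono Phi"
proof -
  interpret prob_space std_normal by (rule prob_space_std_normal)
  show ?thesis
    unfolding Phi_def by (intro monoI finite_measure_mono) auto
qed

text \<open>The density is at most 1 / sqrt (2 pi), hence at most 1; the cruder Lipschitz constant 1
  keeps the later constants simple.\<close>

lemma Phi_add_le:
  assumes "0 \<le> b"
  shows "Phi (x + b) \<le> Phi x + b"
proof -
  interpret prob_space std_normal by (rule prob_space_std_normal)
  have "std_normal_density t \<le> 1" for t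
  proof -
    have "sqrt 1 \<le> sqrt (2 * pi)"
      using pi_ge_two by (intro real_sqrt_le_mono) linarith
    then have "1 / sqrt (2 * pi) \<le> 1" by simp
    then have "1 / sqrt (2 * pi) * exp (- t\<^sup>2 / 2) \<le> 1 * 1"
      by (intro mult_mono) auto
    then show ?thesis by (simp add: std_normal_density_def)
  qed
  then have "ennreal (std_normal_density t) \<le> 1" for t
    by (simp add: ennreal_le_1)
  then have "emeasure std_normal {x<..x + b} \<le> (\<integral>\<^sup>+ t. indicator {x<..x + b} t \<partial>lborel)"
    unfolding std_normal_def
    by (auto simp: emeasure_density indicator_def intro!: nn_integral_mono)
  also have "\<dots> = ennreal b"
    using assms by simp
  finally have "prob {x<..x + b} \<le> b"
    using assms by (simp add: emeasure_eq_measure)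
  moreover have "prob {..x + b} = prob {..x} + prob {x<..x + b}"
    using assms by (subst finite_measure_Union[symmetric]) (auto intro!: arg_cong[where f=prob])
  ultimately show ?thesis
    by (simp add: Phi_def)
qed

section \<open>Smallest p-value of the noise and comparison under the null\<close>

definition min_pval :: "nat \<Rightarrow> nat \<Rightarrow> rmat \<Rightarrow> real \<Rightarrow> real \<Rightarrow> rvec \<Rightarrow> real" where
  "min_pval n p X \<sigma> lam z = Min ((\<lambda>j. 2 * (1 - Phi (acoef n p X \<sigma> lam j * \<bar>z j\<bar>))) ` {..<p})"

definition ridge_noise :: "nat \<Rightarrow> nat \<Rightarrow> rmat \<Rightarrow> real \<Rightarrow> rvec \<Rightarrow> rvec" where
  "ridge_noise n p X lam \<epsilon> = (\<lambda>j. \<Sum>i<n. proj_noise n p X lam j i * \<epsilon> i)"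

lemma min_pval_measurable:
  assumes "1 \<le> p" and z[measurable]: "\<And>j. j < p \<Longrightarrow> (\<lambda>\<omega>. z \<omega> j) \<in> borel_measurable M"
  shows "(\<lambda>\<omega>. min_pval n p X \<sigma> lam (z \<omega>)) \<in> borel_measurable M"
proof -
  have [measurable]: "Phi \<in> borel_measurable borel"
    by (rule borel_measurable_mono[OF mono_Phi])
  have "{..<p} \<noteq> {}" using assms(1) by (auto simp: lessThan_empty_iff)
  then have "min_pval n p X \<sigma> lam (z \<omega>) \<le> a \<longleftrightarrow> (\<exists>j\<in>{..<p}. 2 * (1 - Phi (acoef n p X \<sigma> lam j * \<bar>z \<omega> j\<bar>)) \<le> a)" for \<omega> a
    unfolding min_pval_def by (subst Min_le_iff) auto
  moreover have "{\<omega> \<in> space M. \<exists>j\<in>{..<p}. 2 * (1 - Phi (acoef n p X \<sigma> lam j * \<bar>z \<omega> j\<bar>)) \<le> a} \<in> sets M" for a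
    by (intro sets.sets_Collect_finite_Ex) auto
  ultimately show ?thesis
    unfolding borel_measurable_iff_le by simp
qed

text \<open>Moves the reference law to the noise space on which the data live, so that
  \<open>FZ\<close> is the distribution function of a random variable on that very space.\<close>

lemma FZ_eq:
  assumes "1 \<le> n" "1 \<le> p" "0 < lam" "0 < \<sigma>"
  shows "FZ n p X \<sigma> lam c = measure (noise_law n \<sigma>)
    {\<epsilon> \<in> space (noise_law n \<sigma>). min_pval n p X \<sigma> lam (ridge_noise n p X lam \<epsilon>) \<le> c}"
proof -
  let ?P = "PiM {..<p} (\<lambda>_. borel :: real measure)"
  let ?Z = "\<lambda>\<epsilon>. \<lambda>j\<in>{..<p}. ridge_noise n p X lam \<epsilon> j"
  have law: "gauss_law p (\<lambda>i j. \<sigma>\<^sup>2 / real n * Omega n p X lam i j) = distr (noise_law n \<sigma>) ?P ?Z"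
    unfolding ridge_noise_def
    by (rule gauss_law_eq_linear_noise) (use assms in \<open>simp_all add: Omega_gram\<close>)
  have [measurable]: "?Z \<in> measurable (noise_law n \<sigma>) ?P"
    unfolding ridge_noise_def by measurable
  have [measurable]: "(\<lambda>z. min_pval n p X \<sigma> lam z) \<in> borel_measurable ?P"
    using assms(2) by (intro min_pval_measurable) auto
  have eq: "min_pval n p X \<sigma> lam (?Z \<epsilon>) = min_pval n p X \<sigma> lam (ridge_noise n p X lam \<epsilon>)" for \<epsilon>
    unfolding min_pval_def by (intro arg_cong[where f=Min] image_cong) auto
  have "FZ n p X \<sigma> lam c = measure (distr (noise_law n \<sigma>) ?P ?Z) {z \<in> space ?P. min_pval n p X \<sigma> lam z \<le> c}"
    unfolding FZ_def law by (simp add: min_pval_def)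
  also have "\<dots> = measure (noise_law n \<sigma>) (?Z -` {z \<in> space ?P. min_pval n p X \<sigma> lam z \<le> c} \<inter> space (noise_law n \<sigma>))"
    by (rule measure_distr) measurable
  also have "?Z -` {z \<in> space ?P. min_pval n p X \<sigma> lam z \<le> c} \<inter> space (noise_law n \<sigma>)
      = {\<epsilon> \<in> space (noise_law n \<sigma>). min_pval n p X \<sigma> lam (ridge_noise n p X lam \<epsilon>) \<le> c}"
    by (auto simp: eq space_PiM)
  finally show ?thesis .
qed

text \<open>For a true null the diagonal term of the projection drops out of \<theta> j, leaving
  exactly the sum that the correction estimates; the two differ only by the error of the initial
  estimator.\<close>

lemma ridge_corr_error:
  assumes "0 < lam" "j < p" "\<beta> j = 0"
  shows "ridge_corr n p X lam (response n p X \<beta> \<epsilon>) b j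
    = ridge_noise n p X lam \<epsilon> j - lam * mv p (ridge_res n p X lam) (mv p (PX n p X) \<beta>) j
      - (\<Sum>k\<in>{..<p} - {j}. PX n p X j k * (b k - \<beta> k))"
proof -
  have "mv p (PX n p X) \<beta> j = (\<Sum>k\<in>{..<p} - {j}. PX n p X j k * \<beta> k)"
    unfolding mv_def using assms by (subst sum.remove[of "{..<p}" j]) auto
  then show ?thesis
    using assms by (simp add: ridge_corr_def ridge_response ridge_noise_def right_diff_distrib sum_subtractf)
qed

text \<open>Passing from the j-th diagonal entry of \<Omega> to the minimal one removes the
  dependence on j and produces the sequence assumed to vanish, up to the factor 1 /
  \<sigma>.\<close>

lemma scaled_bias_bound:
  assumes "1 \<le> n" "0 < lam" "0 < \<sigma>" "j < p" "0 < Omega_min n p X lam"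
  shows "acoef n p X \<sigma> lam j * \<bar>lam * mv p (ridge_res n p X lam) (mv p (PX n p X) \<beta>) j\<bar>
    \<le> \<bar>sqrt (real n) * sqrt (\<Sum>i<p. (\<Sum>k<p. PX n p X i k * \<beta> k)\<^sup>2)
          * lam / sqrt (Omega_min n p X lam) / lambda_min_nz p (Sigma_hat n X)\<bar> / \<sigma>"
proof -
  define \<theta> where "\<theta> = mv p (PX n p X) \<beta>"
  have \<theta>: "(\<Sum>i<p. (\<Sum>k<p. PX n p X i k * \<beta> k)\<^sup>2) = dot p \<theta> \<theta>"
    by (simp add: \<theta>_def dot_def mv_def power2_eq_square)
  have "Omega_min n p X lam \<le> Omega n p X lam j j"
    unfolding Omega_min_def using assms(4) by (intro Min_le) auto
  then have "acoef n p X \<sigma> lam j \<le> sqrt (real n) / \<sigma> / sqrt (Omega_min n p X lam)"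
    unfolding acoef_def using assms by (intro divide_left_mono) auto
  then have "acoef n p X \<sigma> lam j * \<bar>lam * mv p (ridge_res n p X lam) \<theta> j\<bar>
      \<le> sqrt (real n) / \<sigma> / sqrt (Omega_min n p X lam) * \<bar>sqrt (dot p \<theta> \<theta>) * lam / lambda_min_nz p (Sigma_hat n X)\<bar>"
    using ridge_bias_bound[OF assms(1,2,4), of X \<beta>] assms unfolding \<theta>_def[symmetric]
    by (intro mult_mono) auto
  also have "\<dots> = \<bar>sqrt (real n) * sqrt (dot p \<theta> \<theta>) * lam / sqrt (Omega_min n p X lam) / lambda_min_nz p (Sigma_hat n X)\<bar> / \<sigma>"
    using assms by (simp add: abs_mult mult_ac)
  finally show ?thesis
    unfolding \<theta> \<theta>_def .
qed

text \<open>The bias allowance is half of \<zeta> because the p-value is twice a normal tail: with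
  Lipschitz constant 1 for \<open>Phi\<close>, a shift by \<zeta> / 2 costs \<zeta>.\<close>

lemma min_pval_le_pval:
  assumes "1 \<le> n" "0 < lam" "0 < \<sigma>" "j < p" "\<beta> j = 0"
    and bias: "acoef n p X \<sigma> lam j * \<bar>lam * mv p (ridge_res n p X lam) (mv p (PX n p X) \<beta>) j\<bar> \<le> \<zeta> / 2"
    and init: "\<bar>acoef n p X \<sigma> lam j * (\<Sum>k\<in>{..<p} - {j}. PX n p X j k * (b k - \<beta> k))\<bar> \<le> \<Delta> j"
    and "0 < \<zeta>"
  shows "min_pval n p X \<sigma> lam (ridge_noise n p X lam \<epsilon>) \<le> pval n p X \<sigma> lam \<Delta> (response n p X \<beta> \<epsilon>) b j + \<zeta>"
proof -
  define a where "a = acoef n p X \<sigma> lam j"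
  define Z where "Z = ridge_noise n p X lam \<epsilon> j"
  define B where "B = lam * mv p (ridge_res n p X lam) (mv p (PX n p X) \<beta>) j"
  define I where "I = (\<Sum>k\<in>{..<p} - {j}. PX n p X j k * (b k - \<beta> k))"
  define x where "x = max 0 (a * \<bar>ridge_corr n p X lam (response n p X \<beta> \<epsilon>) b j\<bar> - \<Delta> j)"
  have "0 \<le> Omega n p X lam j j"
    by (simp add: Omega_gram[OF assms(1,2)] sum_nonneg)
  then have a: "0 \<le> a"
    using assms by (simp add: a_def acoef_def)
  have "a * \<bar>ridge_corr n p X lam (response n p X \<beta> \<epsilon>) b j\<bar> \<le> a * (\<bar>Z\<bar> + \<bar>B\<bar> + \<bar>I\<bar>)"
    unfolding ridge_corr_error[where \<beta>=\<beta> and j=j and p=p, OF assms(2,4,5)] Z_def B_def I_def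
    by (intro mult_left_mono[OF _ a]) linarith
  also have "\<dots> \<le> a * \<bar>Z\<bar> + \<zeta> / 2 + \<Delta> j"
    using bias init a by (simp add: distrib_left abs_mult flip: a_def B_def I_def)
  \<comment> \<open>The right-hand side is nonnegative, so the truncation at 0 in the p-value does
    no harm.\<close>
  finally have "x \<le> a * \<bar>Z\<bar> + \<zeta> / 2"
    using a \<open>0 < \<zeta>\<close> by (simp add: x_def)
  then have "Phi x \<le> Phi (a * \<bar>Z\<bar>) + \<zeta> / 2"
    using monoD[OF mono_Phi, of x "a * \<bar>Z\<bar> + \<zeta> / 2"] Phi_add_le[of "\<zeta> / 2" "a * \<bar>Z\<bar>"] \<open>0 < \<zeta>\<close> by simp
  moreover have "min_pval n p X \<sigma> lam (ridge_noise n p X lam \<epsilon>) \<le> 2 * (1 - Phi (a * \<bar>Z\<bar>))"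
    unfolding min_pval_def a_def Z_def using assms(4) by (intro Min_le) auto
  ultimately show ?thesis
    by (simp add: pval_def flip: a_def x_def)
qed

text \<open>All asymptotics are kept out: at fixed n the bias condition is one numerical inequality,
  and the failure probability of the initial estimator stays as an explicit summand that does not
  involve \<alpha>.\<close>

lemma prob_false_pos_le:
  fixes X :: rmat and \<beta> :: rvec and binit :: "rvec \<Rightarrow> rvec"
  assumes n: "1 \<le> n" "1 \<le> p" and lam: "0 < lam" and \<sigma>: "0 < \<sigma>" and \<zeta>: "0 < \<zeta>" and \<alpha>: "0 \<le> \<alpha>"
    and Omega: "0 < Omega_min n p X lam"
    and bias: "\<bar>sqrt (real n) * sqrt (\<Sum>i<p. (\<Sum>k<p. PX n p X i k * \<beta> k)\<^sup>2)
          * lam / sqrt (Omega_min n p X lam) / lambda_min_nz p (Sigma_hat n X)\<bar> / \<sigma> \<le> \<zeta> / 2"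
    and meas[measurable]: "\<And>j. j < p \<Longrightarrow> (\<lambda>\<epsilon>. binit (response n p X \<beta> \<epsilon>) j) \<in> borel_measurable (noise_law n \<sigma>)"
  shows "measure (noise_law n \<sigma>) {\<epsilon> \<in> space (noise_law n \<sigma>).
        false_pos n p X \<sigma> lam \<Delta> \<zeta> \<beta> (response n p X \<beta> \<epsilon>) (binit (response n p X \<beta> \<epsilon>)) \<alpha> \<noteq> {}}
    \<le> \<alpha> + (1 - measure (noise_law n \<sigma>) {\<epsilon> \<in> space (noise_law n \<sigma>). \<forall>j<p.
        \<bar>acoef n p X \<sigma> lam j * (\<Sum>k\<in>{..<p} - {j}. PX n p X j k * (binit (response n p X \<beta> \<epsilon>) k - \<beta> k))\<bar> \<le> \<Delta> j})"
    (is "?lhs \<le> \<alpha> + (1 - measure _ ?G)")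
proof -
  interpret prob_space "noise_law n \<sigma>"
    by (rule prob_space_noise_law[OF \<sigma>])
  let ?Y = "\<lambda>\<epsilon>. min_pval n p X \<sigma> lam (ridge_noise n p X lam \<epsilon>)"
  let ?H = "{\<epsilon> \<in> space (noise_law n \<sigma>). FZ n p X \<sigma> lam (?Y \<epsilon>) \<le> \<alpha>}"
  have Y[measurable]: "?Y \<in> borel_measurable (noise_law n \<sigma>)"
    using n by (intro min_pval_measurable) (auto simp: ridge_noise_def)
  have F: "FZ n p X \<sigma> lam = (\<lambda>c. prob {\<epsilon> \<in> space (noise_law n \<sigma>). ?Y \<epsilon> \<le> c})"
    using FZ_eq[OF n lam \<sigma>] by blast
  note FZ = cdf_transform_superuniform[OF Y \<alpha>, folded F]
  have [measurable]: "FZ n p X \<sigma> lam \<in> borel_measurable borel"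
    by (rule FZ(2))
  have H: "prob ?H \<le> \<alpha>"
    using cdf_transform_superuniform(1)[OF Y \<alpha>] by (simp add: F)
  have G: "?G \<in> events"
  proof -
    have "{\<epsilon> \<in> space (noise_law n \<sigma>). \<forall>j\<in>{..<p}.
        \<bar>acoef n p X \<sigma> lam j * (\<Sum>k\<in>{..<p} - {j}. PX n p X j k * (binit (response n p X \<beta> \<epsilon>) k - \<beta> k))\<bar> \<le> \<Delta> j} \<in> events"
      by (intro sets.sets_Collect_finite_All borel_measurable_le borel_measurable_abs borel_measurable_times
          borel_measurable_sum borel_measurable_diff meas) auto
    then show ?thesis by simp
  qed
  \<comment> \<open>Monotonicity asks for measurability of the covering event only, which is why
    \<open>?G\<close> and \<open>?H\<close> are the sets shown to be events.\<close>
  have "?lhs \<le> prob (?H \<union> (space (noise_law n \<sigma>) - ?G))"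
  proof (rule finite_measure_mono)
    show "{\<epsilon> \<in> space (noise_law n \<sigma>).
        false_pos n p X \<sigma> lam \<Delta> \<zeta> \<beta> (response n p X \<beta> \<epsilon>) (binit (response n p X \<beta> \<epsilon>)) \<alpha> \<noteq> {}}
      \<subseteq> ?H \<union> (space (noise_law n \<sigma>) - ?G)"
    proof (rule subsetI)
      fix \<epsilon> assume \<epsilon>: "\<epsilon> \<in> {\<epsilon> \<in> space (noise_law n \<sigma>).
        false_pos n p X \<sigma> lam \<Delta> \<zeta> \<beta> (response n p X \<beta> \<epsilon>) (binit (response n p X \<beta> \<epsilon>)) \<alpha> \<noteq> {}}"
      then obtain j where j: "j < p" "\<beta> j = 0"
        "FZ n p X \<sigma> lam (pval n p X \<sigma> lam \<Delta> (response n p X \<beta> \<epsilon>) (binit (response n p X \<beta> \<epsilon>)) j + \<zeta>) \<le> \<alpha>"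
        by (auto simp: false_pos_def pcorr_def)
      show "\<epsilon> \<in> ?H \<union> (space (noise_law n \<sigma>) - ?G)"
      proof (cases "\<epsilon> \<in> ?G")
        case True
        then have "?Y \<epsilon> \<le> pval n p X \<sigma> lam \<Delta> (response n p X \<beta> \<epsilon>) (binit (response n p X \<beta> \<epsilon>)) j + \<zeta>"
          using j n lam \<sigma> \<zeta> by (intro min_pval_le_pval order_trans[OF scaled_bias_bound[OF n(1) lam \<sigma> j(1) Omega] bias]) auto
        then have "FZ n p X \<sigma> lam (?Y \<epsilon>) \<le> \<alpha>"
          using monoD[OF FZ(3)] j(3) order_trans by blast
        then show ?thesis using \<epsilon> by auto
      qed (use \<epsilon> in auto)
    qed
    show "?H \<union> (space (noise_law n \<sigma>) - ?G) \<in> events"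
      using G by (intro sets.Un sets.Diff) auto
  qed
  also have "\<dots> \<le> prob ?H + prob (space (noise_law n \<sigma>) - ?G)"
    using G by (intro measure_Un_le) auto
  also have "\<dots> \<le> \<alpha> + (1 - prob ?G)"
    using H prob_compl[OF G] by simp
  finally show ?thesis .
qed

theorem theorem2:
  fixes p :: "nat \<Rightarrow> nat" and X :: "nat \<Rightarrow> rmat" and \<beta>0 :: "nat \<Rightarrow> rvec"
    and \<sigma> :: real and lam :: "nat \<Rightarrow> real"
    and binit :: "nat \<Rightarrow> rvec \<Rightarrow> rvec" and \<Delta> :: "nat \<Rightarrow> nat \<Rightarrow> real" and \<zeta> :: real
  assumes p_pos: "\<And>n. 1 \<le> p n"
    and sigma_pos: "0 < \<sigma>"
    and lam_pos: "\<And>n. 1 \<le> n \<Longrightarrow> 0 < lam n"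
    and Omega_min_pos: "\<And>n. 1 \<le> n \<Longrightarrow> 0 < Omega_min n (p n) (X n) (lam n)"
    and bias_cond: "(\<lambda>n. sqrt (real n)
          * sqrt (\<Sum>i<p n. (\<Sum>k<p n. PX n (p n) (X n) i k * \<beta>0 n k)\<^sup>2)
          * lam n / sqrt (Omega_min n (p n) (X n) (lam n))
          / lambda_min_nz (p n) (Sigma_hat n (X n))) \<longlonglongrightarrow> 0"
    and binit_meas: "\<And>n j. 1 \<le> n \<Longrightarrow> j < p n \<Longrightarrow>
          (\<lambda>\<epsilon>. binit n (response n (p n) (X n) (\<beta>0 n) \<epsilon>) j) \<in> borel_measurable (noise_law n \<sigma>)"
    and Delta_pos: "\<And>n j. 0 < \<Delta> n j"
    and init_cond: "(\<lambda>n. measure (noise_law n \<sigma>)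
          {\<epsilon> \<in> space (noise_law n \<sigma>). \<forall>j<p n.
             \<bar>acoef n (p n) (X n) \<sigma> (lam n) j
               * (\<Sum>k\<in>{..<p n} - {j}. PX n (p n) (X n) j k
                    * (binit n (response n (p n) (X n) (\<beta>0 n) \<epsilon>) k - \<beta>0 n k))\<bar> \<le> \<Delta> n j})
        \<longlonglongrightarrow> 1"
    and zeta_pos: "0 < \<zeta>"
  shows "(\<forall>\<alpha>. 0 < \<alpha> \<and> \<alpha> < 1 \<longrightarrow>
           limsup (\<lambda>n. ereal (measure (noise_law n \<sigma>)
             {\<epsilon> \<in> space (noise_law n \<sigma>).
                false_pos n (p n) (X n) \<sigma> (lam n) (\<Delta> n) \<zeta> (\<beta>0 n)
                  (response n (p n) (X n) (\<beta>0 n) \<epsilon>)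
                  (binit n (response n (p n) (X n) (\<beta>0 n) \<epsilon>)) \<alpha> \<noteq> {}})) \<le> ereal \<alpha>)
       \<and> (\<exists>\<eta> :: nat \<Rightarrow> real. \<eta> \<longlonglongrightarrow> 0 \<and>
           (\<forall>\<alpha>s :: nat \<Rightarrow> real. (\<forall>n. 0 < \<alpha>s n \<and> \<alpha>s n < 1) \<longrightarrow> \<alpha>s \<longlonglongrightarrow> 0 \<longrightarrow>
              (\<forall>n. \<eta> n \<le> \<alpha>s n) \<longrightarrow>
              limsup (\<lambda>n. ereal (measure (noise_law n \<sigma>)
                {\<epsilon> \<in> space (noise_law n \<sigma>).
                   false_pos n (p n) (X n) \<sigma> (lam n) (\<Delta> n) \<zeta> (\<beta>0 n)
                     (response n (p n) (X n) (\<beta>0 n) \<epsilon>)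
                     (binit n (response n (p n) (X n) (\<beta>0 n) \<epsilon>)) (\<alpha>s n) \<noteq> {}}
                 - \<alpha>s n)) \<le> 0))"
proof -
  define bn where "bn = (\<lambda>n. sqrt (real n)
          * sqrt (\<Sum>i<p n. (\<Sum>k<p n. PX n (p n) (X n) i k * \<beta>0 n k)\<^sup>2)
          * lam n / sqrt (Omega_min n (p n) (X n) (lam n))
          / lambda_min_nz (p n) (Sigma_hat n (X n)))"
  define good where "good = (\<lambda>n. measure (noise_law n \<sigma>)
          {\<epsilon> \<in> space (noise_law n \<sigma>). \<forall>j<p n.
             \<bar>acoef n (p n) (X n) \<sigma> (lam n) j
               * (\<Sum>k\<in>{..<p n} - {j}. PX n (p n) (X n) j k
                    * (binit n (response n (p n) (X n) (\<beta>0 n) \<epsilon>) k - \<beta>0 n k))\<bar> \<le> \<Delta> n j})"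
  define bad where "bad = (\<lambda>n \<alpha>. measure (noise_law n \<sigma>)
             {\<epsilon> \<in> space (noise_law n \<sigma>).
                false_pos n (p n) (X n) \<sigma> (lam n) (\<Delta> n) \<zeta> (\<beta>0 n)
                  (response n (p n) (X n) (\<beta>0 n) \<epsilon>)
                  (binit n (response n (p n) (X n) (\<beta>0 n) \<epsilon>)) \<alpha> \<noteq> {}})"
  have "(\<lambda>n. \<bar>bn n\<bar> / \<sigma>) \<longlonglongrightarrow> \<bar>0\<bar> / \<sigma>"
    using bias_cond sigma_pos unfolding bn_def by (intro tendsto_intros) auto
  then have "\<forall>\<^sub>F n in sequentially. \<bar>bn n\<bar> / \<sigma> < \<zeta> / 2"
    using zeta_pos by (intro order_tendstoD(2)) auto
  \<comment> \<open>The quantifier over \<alpha> stands inside the eventuality: the threshold for n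
    is common to all levels, so a varying level can be inserted afterwards.\<close>
  then have bound: "\<forall>\<^sub>F n in sequentially. \<forall>\<alpha>\<ge>0. bad n \<alpha> \<le> \<alpha> + (1 - good n)"
    using eventually_ge_at_top[of 1]
  proof eventually_elim
    case (elim n)
    show ?case
      unfolding bad_def good_def
      using elim p_pos lam_pos sigma_pos zeta_pos Omega_min_pos binit_meas unfolding bn_def
      by (intro allI impI prob_false_pos_le) auto
  qed
  have good: "(\<lambda>n. \<alpha> + (1 - good n)) \<longlonglongrightarrow> \<alpha>" for \<alpha>
    using tendsto_add[OF tendsto_const tendsto_diff[OF tendsto_const init_cond[folded good_def]], of \<alpha> 1] by simp
  \<comment> \<open>Stated for a general sequence f so as to serve both claims: f is the error
    probability with limit \<alpha>, or that probability minus the varying level, with limit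
    0.\<close>
  have limsup_le: "limsup (\<lambda>n. ereal (f n)) \<le> ereal \<alpha>"
    if "\<forall>\<^sub>F n in sequentially. f n \<le> \<alpha> + (1 - good n)" for f \<alpha>
  proof -
    have "limsup (\<lambda>n. ereal (f n)) \<le> limsup (\<lambda>n. ereal (\<alpha> + (1 - good n)))"
      using that by (intro Limsup_mono) (simp add: eventually_mono)
    also have "\<dots> = ereal \<alpha>"
      by (intro lim_imp_Limsup tendsto_ereal good) simp
    finally show ?thesis .
  qed
  have "(\<forall>\<alpha>. 0 < \<alpha> \<and> \<alpha> < 1 \<longrightarrow> limsup (\<lambda>n. ereal (bad n \<alpha>)) \<le> ereal \<alpha>)
    \<and> (\<exists>\<eta> :: nat \<Rightarrow> real. \<eta> \<longlonglongrightarrow> 0 \<and>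
          (\<forall>\<alpha>s :: nat \<Rightarrow> real. (\<forall>n. 0 < \<alpha>s n \<and> \<alpha>s n < 1) \<longrightarrow> \<alpha>s \<longlonglongrightarrow> 0 \<longrightarrow>
            (\<forall>n. \<eta> n \<le> \<alpha>s n) \<longrightarrow> limsup (\<lambda>n. ereal (bad n (\<alpha>s n) - \<alpha>s n)) \<le> 0))"
  proof (intro conjI allI impI exI[of _ "\<lambda>_. 0"])
    fix \<alpha> :: real assume "0 < \<alpha> \<and> \<alpha> < 1"
    then show "limsup (\<lambda>n. ereal (bad n \<alpha>)) \<le> ereal \<alpha>"
      by (intro limsup_le eventually_mono[OF bound]) auto
  next
    fix \<alpha>s :: "nat \<Rightarrow> real" assume "\<forall>n. 0 < \<alpha>s n \<and> \<alpha>s n < 1"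
    then have "limsup (\<lambda>n. ereal (bad n (\<alpha>s n) - \<alpha>s n)) \<le> ereal 0"
      by (intro limsup_le eventually_mono[OF bound]) (auto simp: less_imp_le diff_le_eq add.commute)
    then show "limsup (\<lambda>n. ereal (bad n (\<alpha>s n) - \<alpha>s n)) \<le> 0"
      by (simp add: zero_ereal_def)
  qed simp
  then show ?thesis
    unfolding bad_def .
qed

end
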